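(* Consider a formation of $n$ fixed-wing UAVs in three-dimensional space ($d=3$) with the UAV model, leader motion, bearing Laplacian and stress matrix described in the context. Suppose Assumptions A1 (nominal formation), A2 (desired formation) and A3 (no collision) of the context hold. Let every follower $i\in\mathcal V_f=\{n_l+1,\dots,n\}$ use the bearing-based localization-and-tracking scheme \[ \dot{\hat{p}}_i=-k_\delta\sum_{j\in\mathcal N_i^f}\pi_{g_{ij}}(\hat p_i-\hat p_j)-k_\delta\sum_{j\in\mathcal N_i^l}\pi_{g_{ij}}(\hat p_i-p_j)+\dot p_i, \] \[ \tau_i=-h_i^Tf_i,\qquad \omega_i=-\frac1{v_i}\,h_i\times f_i+\aleph_i, \] \[ f_i=\sum_{j\in\mathcal N_i^f}k_p\varpi_{ij}(\hat p_i-\hat p_j)+\sum_{j\in\mathcal N_i^l}k_p\varpi_{ij}(\hat p_i-p_j)+\sum_{j\in\mathcal N_i}k_v\varpi_{ij}(h_iv_i-h_jv_j), \] where $k_\delta,k_p,k_v>0$ are constants and $\aleph_i$ is a vector satisfying $\aleph_i^\wedge h_i=\frac{v_i^*}{v_i}\,\omega_r^\wedge h_r$. Put $\delta_i=\hat p_i-p_i$, $\tilde p_i=p_i-p_i^*$, $e_{vi}=\dot p_i-\dot p_i^*$ for $i\in\mathcal V_f$, and let $\delta_f,\tilde p_f,e_{vf}\in\mathbb R^{dn_f}$ be the corresponding stacked vectors. The closed-loop error dynamics are \[ \begin{bmatrix}\dot\delta_f\\ \dot{\tilde p}_f\\ \dot e_{vf}\end{bmatrix}=\begin{bmatrix}-k_\delta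 L_{Bff}(t)&0&0\\0&0&I_{dn_f}\\-k_p\bar\Omega_{ff}&-k_p\bar\Omega_{ff}&-k_v\bar\Omega_{ff}\end{bmatrix}\begin{bmatrix}\delta_f\\ \tilde p_f\\ e_{vf}\end{bmatrix},\qquad (\ast) \] where $L_{Bff}(t)$ is evaluated at the actual bearings of the UAVs at time $t$. Then: (i) The equilibrium set of $(\ast)$ (the states at which the right-hand side vanishes) is \[ \Xi_{es}=\{(\delta_f,\tilde p_f,e_{vf}) : L_{Bff}(t)\delta_f(t)=0,\ \tilde p_f(t)+\delta_f(t)=0,\ e_{vf}(t)=0\} \] \[ =\{(\delta_f,\tilde p_f,e_{vf}) : L_{Bff}(t)\delta_f(t)=0,\ \hat p_f(t)=p_f^*(t),\ e_{vf}(t)=0\}. \] (ii) If there exist positive scalars $T$ and $\alpha$ such that for all $t>0$ \[ \int_t^{t+T}L_{Bff}(\tau)\,d\tau\ \ge\ \alpha I_{dn_f} \] (in the order of symmetric matrices), then every solution of $(\ast)$ is bounded, and the origin $(\delta_f,\tilde p_f,e_{vf})=(0,0,0)$ is exponentially approached by all bounded solutions.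
   Context: Graph. $\mathcal G=(\mathcal V,\mathcal E)$ is a fixed connected undirected graph with $\mathcal V=\{1,\dots,n\}$ and $|\mathcal E|=m$. Leaders are $\mathcal V_l=\{1,\dots,n_l\}$, followers $\mathcal V_f=\mathcal V\setminus\mathcal V_l$, $n_f=n-n_l$. $\mathcal N_i$ is the neighbor set of $i$, $\mathcal N_i^l=\mathcal N_i\cap\mathcal V_l$, $\mathcal N_i^f=\mathcal N_i\cap\mathcal V_f$. Positions are $p_i\in\mathbb R^d$, $p=[p_l^T,p_f^T]^T$ (leaders first), $d=3$. Hatted quantities $\hat p_i$ are position estimates; $\hat p_f$ stacks the followers' estimates. UAV model. UAV $i$ is described by $\dot x_i=v_i\cos\alpha_i\cos\beta_i$, $\dot y_i=v_i\cos\alpha_i\sin\beta_i$, $\dot z_i=v_i\sin\alpha_i$, $\dot v_i=-g\sin\alpha_i+(T_i-F_i)/m_i$, $\dot\alpha_i=\frac1{m_iv_i}(L_i\cos\varrho_i-m_ig\cos\alpha_i)$, $\dot\beta_i=\frac{L_i\sin\varrho_i}{m_iv_i\cos\alpha_i}$, where $p_i=[x_i,y_i,z_i]^T$, $v_i$ is speed, $\alpha_i$ flight path angle, $\beta_i$ heading angle, $m_i$ mass, $g$ gravity acceleration, $F_i$ air friction, and $T_i,L_i,\varrho_i$ (thrust, lift, banking angle) are the inputs. Control design uses the reformulated equivalent model \[ \dot p_i=v_ih_i,\qquad \dot h_i=\omega_i^\wedge h_i,\qquad \dot v_i=\tau_i, \] with unit heading vector $h_i=[\cos\beta_i\cos\alpha_i,\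 \sin\beta_i\cos\alpha_i,\ \sin\alpha_i]^T$ and control inputs $\tau_i\in\mathbb R$ (virtual thrust) and $\omega_i\in\mathbb R^3$ (angular velocity in the inertial frame). With $\chi_i=-\alpha_i$, the physical inputs are recovered by $T_i=m_i\tau_i+F_i-m_ig\sin\chi_i$, $L_i=m_i\sqrt{(v_i\cos\chi_i\,\omega_i^z)^2+(g\cos\chi_i-v_i\dot\chi_i)^2}$, $\varrho_i=\tan^{-1}\big(\frac{v_i\cos\chi_i\,\omega_i^z}{g\cos\chi_i-v_i\dot\chi_i}\big)$. Here $a^\wedge$ is the skew-symmetric $3\times3$ matrix with $a^\wedge b=a\times b$. It is implicit that the scheme is well defined along the trajectories considered, i.e. $v_i\ne0$ and $\aleph_i$ with the required property exists for all followers. Bearings. $e_{ij}=p_j-p_i$, $g_{ij}=e_{ij}/\|e_{ij}\|$, $\pi_{g_{ij}}=I_d-g_{ij}g_{ij}^T$. Orient each edge arbitrarily; $H\in\mathbb R^{m\times n}$ is the incidence matrix (entry $1$ at the head of the edge, $-1$ at the tail, $0$ otherwise), $\bar H=H\otimes I_d$, $\Pi=\operatorname{diag}(\pi_{g_k})\in\mathbb R^{dm\times dm}$ (block diagonal over edges $k$). The bearing Laplacian is $L_B=\bar H^T\Pi\bar H\in\mathbb R^{dn\times dn}$; $L_{Bff}\in\mathbb R^{dn_f\times dn_f}$ is its follower-follower diagonal block. Stress matrix. Scalars $\varpi_{ij}=\varpi_{ji}$, $(i,j)\in\mathcal E$, form an equilibrium stress of $(\mathcal G,r)$ if $\sum_{j\in\mathcal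 N_i}\varpi_{ij}(r_j-r_i)=0$ for all $i$. The stress matrix $\Omega\in\mathbb R^{n\times n}$ has $[\Omega]_{ij}=-\varpi_{ij}$ for $j\in\mathcal N_i$, $0$ for $j\notin\mathcal N_i$, $j\ne i$, and $[\Omega]_{ii}=\sum_{k\in\mathcal N_i}\varpi_{ik}$. $\bar\Omega=\Omega\otimes I_d$, with blocks $\bar\Omega_{ll},\bar\Omega_{lf},\bar\Omega_{fl},\bar\Omega_{ff}$ according to the leader/follower partition. The $\varpi_{ij}$ in the control scheme are those of an equilibrium stress of the nominal formation. Target formation. A constant nominal configuration $r=[r_1^T,\dots,r_n^T]^T$, $r_i\in\mathbb R^d$, is given. The desired positions are $p_i^*(t)=A(t)r_i+b(t)$ with $A(t)\in\mathbb R^{d\times d}$ invertible, $b(t)\in\mathbb R^d$, both continuous in $t$. Let $\mathcal A(r)=\{p\in\mathbb R^{dn}:p_i=Ar_i+b\ \forall i,\ A\in\mathbb R^{d\times d},\ b\in\mathbb R^d\}$. $(\mathcal G,r)$ is affinely localizable by the leaders if for every $p=[p_l^T,p_f^T]^T\in\mathcal A(r)$, $p_f$ is uniquely determined by $p_l$. $e_{ij}^*=p_j^*-p_i^*$. Leaders. Leaders are exactly on target, $p_i(t)=p_i^*(t)$ for $i\in\mathcal V_l$. They move with zero virtual thrust (constant speeds $v_i$), a common constant angular velocity $\omega_r$ and a common heading vector $h_r$, so $\ddot p_i=v_i\,\omega_r^\wedge h_r$ for $i\in\mathcal V_l$; for followers, $v_i^*$ denotes the desired speed, and the desired positions satisfy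 $\ddot p_i^*=v_i^*\,\omega_r^\wedge h_r$. Assumption A1. (i) $\{r_i\}_{i=1}^n$ affinely span $\mathbb R^d$; (ii) the stress matrix $\Omega$ of $(\mathcal G,r)$ is positive semi-definite with $\operatorname{rank}(\Omega)=n-d-1$; (iii) $(\mathcal G,r)$ is affinely localizable by the selected leaders. (Under A1, $\bar\Omega_{ff}$ is positive definite and $p_f^*=-\bar\Omega_{ff}^{-1}\bar\Omega_{fl}p_l^*$.) Assumption A2. Each $p_i^*(t)$ is twice differentiable in $t$; $p_i^*(t)$ and $\dot p_i^*(t)$ are bounded for all $t$; and $\|e_{ij}^*(t)\|>0$ for $j\in\mathcal N_i$. Assumption A3. $p_i(t)\neq p_j(t)$ for all $j\in\mathcal N_i$ and all $t\ge0$. *)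

theory Defs
  imports "HOL-Analysis.Analysis"
begin

(* Vertices have type 'l + 'f: leaders are the Inl i, followers the Inr i.
   A block vector with blocks indexed by 'v in R^d is a vector indexed by 'v * 'd. *)

section \<open>Matrices\<close>

definition kron ::
  "real ^ 'n ^ 'm \<Rightarrow> real ^ 'q ^ 'p \<Rightarrow> real ^ ('n \<times> 'q) ^ ('m \<times> 'p)"
  where "kron A B = (\<chi> ia jb. A $ fst ia $ fst jb * B $ snd ia $ snd jb)"

definition block_diag :: "('e::finite \<Rightarrow> real ^ 'd ^ 'd) \<Rightarrow> real ^ ('e \<times> 'd) ^ ('e \<times> 'd)"
  where "block_diag P = (\<chi> ka lb. if fst ka = fst lb then P (fst ka) $ snd ka $ snd lb else 0)"

definition ff_block ::
  "real ^ (('l::finite + 'f::finite) \<times> 'd::finite) ^ (('l + 'f) \<times> 'd) \<Rightarrow> real ^ ('f \<times> 'd) ^ ('f \<times> 'd)"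
  where "ff_block M = (\<chi> ia jb. M $ (Inr (fst ia), snd ia) $ (Inr (fst jb), snd jb))"

definition stack :: "('v::finite \<Rightarrow> real ^ 'd) \<Rightarrow> real ^ ('v \<times> 'd)"
  where "stack u = (\<chi> ia. u (fst ia) $ snd ia)"

definition psd :: "real ^ 'n ^ 'n \<Rightarrow> bool"
  where "psd M \<longleftrightarrow> transpose M = M \<and> (\<forall>x. 0 \<le> x \<bullet> (M *v x))"

(* The instance of \<le> on vectors and matrices is componentwise, hence a separate constant. *)
definition loewner_le :: "real ^ 'n ^ 'n \<Rightarrow> real ^ 'n ^ 'n \<Rightarrow> bool"
  where "loewner_le M N \<longleftrightarrow> psd (N - M)"

definition skew :: "real ^ 3 \<Rightarrow> real ^ 3 ^ 3"
  where "skew a = matrix (cross3 a)"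

definition heading :: "real \<Rightarrow> real \<Rightarrow> real ^ 3"
  where "heading al be = vector [cos be * cos al, sin be * cos al, sin al]"

section \<open>Graphs\<close>

definition simple_graph :: "'v set set \<Rightarrow> bool"
  where "simple_graph E \<longleftrightarrow> (\<forall>e\<in>E. card e = 2)"

definition nbrs :: "'v set set \<Rightarrow> 'v \<Rightarrow> 'v set"
  where "nbrs E i = {j. {i, j} \<in> E}"

definition nbrs_l :: "('l + 'f) set set \<Rightarrow> 'l + 'f \<Rightarrow> 'l set"
  where "nbrs_l E i = {j. Inl j \<in> nbrs E i}"

definition nbrs_f :: "('l + 'f) set set \<Rightarrow> 'l + 'f \<Rightarrow> 'f set"
  where "nbrs_f E i = {j. Inr j \<in> nbrs E i}"

definition connected_graph :: "'v set set \<Rightarrow> bool"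
  where "connected_graph E \<longleftrightarrow> (\<forall>i j. (i, j) \<in> {(a, b). b \<in> nbrs E a}\<^sup>*)"

(* The type 'e indexes the edges, so that CARD('e) = card E. *)
definition orientation :: "'v set set \<Rightarrow> ('e \<Rightarrow> 'v) \<Rightarrow> ('e \<Rightarrow> 'v) \<Rightarrow> bool"
  where "orientation E tail head \<longleftrightarrow> bij_betw (\<lambda>k. {tail k, head k}) UNIV E"

definition incidence :: "('e::finite \<Rightarrow> 'v::finite) \<Rightarrow> ('e \<Rightarrow> 'v) \<Rightarrow> real ^ 'v ^ 'e"
  where "incidence tail head = (\<chi> k i. if i = head k then 1 else if i = tail k then - 1 else 0)"

section \<open>Bearings\<close>

definition bearing :: "('v::finite \<Rightarrow> real ^ 'd) \<Rightarrow> 'v \<Rightarrow> 'v \<Rightarrow> real ^ 'd"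
  where "bearing p i j = (p j - p i) /\<^sub>R norm (p j - p i)"

definition orth_proj :: "real ^ 'd \<Rightarrow> real ^ 'd ^ 'd"
  where "orth_proj g = mat 1 - (\<chi> a b. g $ a * g $ b)"

definition bearing_laplacian ::
  "('e::finite \<Rightarrow> 'v::finite) \<Rightarrow> ('e \<Rightarrow> 'v) \<Rightarrow> ('v \<Rightarrow> real ^ 'd) \<Rightarrow> real ^ ('v \<times> 'd) ^ ('v \<times> 'd)"
  where "bearing_laplacian tail head p =
    (let Hbar = kron (incidence tail head) (mat 1 :: real ^ 'd ^ 'd);
         P = block_diag (\<lambda>k. orth_proj (bearing p (tail k) (head k)))
     in transpose Hbar ** P ** Hbar)"

definition L_Bff ::
  "('e::finite \<Rightarrow> 'l::finite + 'f::finite) \<Rightarrow> ('e \<Rightarrow> 'l + 'f) \<Rightarrow> ('l + 'f \<Rightarrow> real ^ 'd)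
    \<Rightarrow> real ^ ('f \<times> 'd) ^ ('f \<times> 'd)"
  where "L_Bff tail head p = ff_block (bearing_laplacian tail head p)"

section \<open>Stresses and affine formations\<close>

(* Only the values of w on edges matter. *)
definition equilibrium_stress ::
  "('v::finite) set set \<Rightarrow> ('v \<Rightarrow> real ^ 'd) \<Rightarrow> ('v \<Rightarrow> 'v \<Rightarrow> real) \<Rightarrow> bool"
  where "equilibrium_stress E r w \<longleftrightarrow>
    (\<forall>i. \<forall>j\<in>nbrs E i. w i j = w j i) \<and>
    (\<forall>i. (\<Sum>j\<in>nbrs E i. w i j *\<^sub>R (r j - r i)) = 0)"

definition stress_matrix :: "('v::finite) set set \<Rightarrow> ('v \<Rightarrow> 'v \<Rightarrow> real) \<Rightarrow> real ^ 'v ^ 'v"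
  where "stress_matrix E w = (\<chi> i j.
    if i = j then (\<Sum>k\<in>nbrs E i. w i k) else if j \<in> nbrs E i then - w i j else 0)"

definition Omega_ff ::
  "('l::finite + 'f::finite) set set \<Rightarrow> ('l + 'f \<Rightarrow> 'l + 'f \<Rightarrow> real) \<Rightarrow> real ^ ('f \<times> 'd::finite) ^ ('f \<times> 'd)"
  where "Omega_ff E w = ff_block (kron (stress_matrix E w) (mat 1 :: real ^ 'd ^ 'd))"

definition affine_image :: "('v::finite \<Rightarrow> real ^ 'd) \<Rightarrow> ('v \<Rightarrow> real ^ 'd) set"
  where "affine_image r = {p. \<exists>(A :: real ^ 'd ^ 'd) b. \<forall>i. p i = A *v r i + b}"

definition affinely_localizable :: "('l::finite + 'f::finite \<Rightarrow> real ^ 'd) \<Rightarrow> bool"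
  where "affinely_localizable r \<longleftrightarrow>
    (\<forall>p\<in>affine_image r. \<forall>q\<in>affine_image r.
       (\<forall>i. p (Inl i) = q (Inl i)) \<longrightarrow> (\<forall>j. p (Inr j) = q (Inr j)))"

section \<open>Error dynamics\<close>

type_synonym ('f, 'd) err_state =
  "(real ^ ('f \<times> 'd)) \<times> (real ^ ('f \<times> 'd)) \<times> (real ^ ('f \<times> 'd))"

definition err_rhs ::
  "real \<Rightarrow> real \<Rightarrow> real \<Rightarrow> real ^ ('f::finite \<times> 'd::finite) ^ ('f \<times> 'd) \<Rightarrow> real ^ ('f \<times> 'd) ^ ('f \<times> 'd)
    \<Rightarrow> ('f, 'd) err_state \<Rightarrow> ('f, 'd) err_state"
  where "err_rhs kd kp kv Om L = (\<lambda>(\<delta>, pt, ev).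
    (- kd *\<^sub>R (L *v \<delta>),
     ev,
     - kp *\<^sub>R (Om *v \<delta>) - kp *\<^sub>R (Om *v pt) - kv *\<^sub>R (Om *v ev)))"

definition err_solution ::
  "real \<Rightarrow> real \<Rightarrow> real \<Rightarrow> real ^ ('f::finite \<times> 'd::finite) ^ ('f \<times> 'd)
    \<Rightarrow> (real \<Rightarrow> real ^ ('f \<times> 'd) ^ ('f \<times> 'd)) \<Rightarrow> (real \<Rightarrow> ('f, 'd) err_state) \<Rightarrow> bool"
  where "err_solution kd kp kv Om L x \<longleftrightarrow>
    (\<forall>t\<ge>0. (x has_vector_derivative err_rhs kd kp kv Om (L t) (x t)) (at t within {0..}))"

end

(* Because the stress is in equilibrium with every affine image of r, the desired positions and
   velocities drop out of the control law, which leaves the linear cascade (\<delta>, (p, e)).  The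
   kernel of the stress matrix has dimension d + 1, hence consists of the affine functions of r; by
   localizability none of them vanishes on all leaders but not on all followers, so Omega_ff is
   positive definite.  Under persistent excitation |\<delta>|^2 contracts by a fixed factor over each
   window of length T, and a quadratic Lyapunov function of the second-order part transfers the
   decay of \<delta> to the tracking errors. *)
theory Submission
  imports Defs
begin

section \<open>Positive semidefinite matrices\<close>

text \<open>The obstacle is that \<open>L t\<close> may be singular at every instant: only its
  integral over a window is definite. Excitation thus speaks about a fixed vector, while \<delta>
  moves inside the window. The link is that \<delta> cannot move without paying: a bound
  \<open>B\<close> on \<open>L t\<close> gives |L \<delta>|^2 \<le> B (\<delta> . L \<delta>), so
  the displacement is controlled by the drop of |\<delta>|^2. Hence the starting value of \<delta>
  can be tested in the integral at the price of this drop. The bound must not depend on time; it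
  exists because projections never exceed the identity, whatever the configuration.

  All constants are fixed before a solution is chosen, so one pair \<open>C\<close>,
  \<open>c\<close> serves every solution.

  In the closed loop, the true positions leave the estimator because each bearing projection
  annihilates the relative position that defines it. For the desired velocities, \<open>A\<close>
  and \<open>b\<close> are only continuous, so their equilibrium property is obtained by
  differentiating the identity for the desired positions.\<close>

lemma psd_symmetric: "psd M \<Longrightarrow> x \<bullet> (M *v y) = y \<bullet> (M *v x)"
  unfolding psd_def by (metis dot_lmul_matrix inner_commute transpose_matrix_vector)

text \<open>Expanding the form of \<open>M\<close> at \<open>B x - M x\<close>, which is
  nonnegative, gives the estimate without a spectral decomposition. It bounds the speed of a
  gradient-like flow by its dissipation.\<close>

lemma psd_norm_mult_le:
  fixes M :: "real ^ 'n ^ 'n"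
  assumes M: "psd M" and B: "\<And>x. x \<bullet> (M *v x) \<le> B * (norm x)\<^sup>2" and "B > 0"
  shows "(norm (M *v x))\<^sup>2 \<le> B * (x \<bullet> (M *v x))"
proof -
  let ?y = "M *v x"
  let ?z = "B *\<^sub>R x - ?y"
  have "0 \<le> ?z \<bullet> (M *v ?z)"
    using M by (auto simp: psd_def)
  also have "\<dots> = B * B * (x \<bullet> ?y) - 2 * B * (norm ?y)\<^sup>2 + ?y \<bullet> (M *v ?y)"
    using psd_symmetric[OF M, of x ?y]
    by (simp add: matrix_vector_mult_diff_distrib matrix_vector_mult_scaleR inner_diff
        power2_norm_eq_inner algebra_simps)
  also have "\<dots> \<le> B * B * (x \<bullet> ?y) - 2 * B * (norm ?y)\<^sup>2 + B * (norm ?y)\<^sup>2"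
    using B by simp
  finally have "0 \<le> B * (B * (x \<bullet> ?y) - (norm ?y)\<^sup>2)"
    by (simp add: algebra_simps)
  then show ?thesis
    using \<open>B > 0\<close> by (simp add: zero_le_mult_iff)
qed

lemma matrix_quadratic_bound:
  fixes M :: "real ^ 'n ^ 'n"
  obtains B where "B > 0" "\<And>x. x \<bullet> (M *v x) \<le> B * (norm x)\<^sup>2" "\<And>x. norm (M *v x) \<le> B * norm x"
proof -
  obtain B where B: "B > 0" "\<And>x. norm (M *v x) \<le> norm x * B"
    using bounded_linear.pos_bounded[OF matrix_vector_mul_bounded_linear[of M]] by blast
  show thesis
  proof (rule that[OF B(1)])
    fix x :: "real ^ 'n"
    show 1: "norm (M *v x) \<le> B * norm x"
      using B(2) by (simp add: mult.commute)
    have "x \<bullet> (M *v x) \<le> norm x * norm (M *v x)"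
      by (rule norm_cauchy_schwarz)
    also have "\<dots> \<le> norm x * (B * norm x)"
      using 1 by (simp add: mult_left_mono)
    finally show "x \<bullet> (M *v x) \<le> B * (norm x)\<^sup>2"
      by (simp add: power2_eq_square algebra_simps)
  qed
qed

lemma psd_kernel:
  fixes M :: "real ^ 'n ^ 'n"
  assumes M: "psd M" and "x \<bullet> (M *v x) = 0"
  shows "M *v x = 0"
proof -
  obtain B where "B > 0" "\<And>x. x \<bullet> (M *v x) \<le> B * (norm x)\<^sup>2"
    using matrix_quadratic_bound by metis
  from psd_norm_mult_le[OF M this(2,1), of x] show ?thesis
    using assms(2) by simp
qed

text \<open>The form attains its minimum on the compact unit sphere; homogeneity extends this value
  to all vectors.\<close>

lemma positive_definite_coercive:
  fixes M :: "real ^ 'n ^ 'n"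
  assumes pos: "\<And>x. x \<noteq> 0 \<Longrightarrow> 0 < x \<bullet> (M *v x)"
  obtains \<mu> where "\<mu> > 0" "\<And>x. \<mu> * (norm x)\<^sup>2 \<le> x \<bullet> (M *v x)"
proof -
  have "continuous_on (sphere 0 1) (\<lambda>x. x \<bullet> (M *v x))"
    by (intro continuous_intros linear_continuous_on matrix_vector_mul_bounded_linear)
  moreover have "axis undefined 1 \<in> sphere (0 :: real ^ 'n) 1"
    by (simp add: norm_axis_1)
  ultimately obtain z :: "real ^ 'n" where z: "norm z = 1"
    "\<And>x. norm x = 1 \<Longrightarrow> z \<bullet> (M *v z) \<le> x \<bullet> (M *v x)"
    using continuous_attains_inf[of "sphere 0 1" "\<lambda>x. x \<bullet> (M *v x)"] by fastforce
  show thesis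
  proof
    show "0 < z \<bullet> (M *v z)" using z(1) pos[of z] by force
    fix x :: "real ^ 'n"
    show "(z \<bullet> (M *v z)) * (norm x)\<^sup>2 \<le> x \<bullet> (M *v x)"
    proof (cases "x = 0")
      case False
      have "z \<bullet> (M *v z) \<le> sgn x \<bullet> (M *v sgn x)"
        using False by (intro z(2)) (simp add: norm_sgn)
      also have "\<dots> = (x \<bullet> (M *v x)) / (norm x)\<^sup>2"
        by (simp add: sgn_div_norm matrix_vector_mult_scaleR power2_eq_square divide_simps)
      finally show ?thesis using False by (simp add: field_simps)
    qed simp
  qed
qed

section \<open>Exponential stability of the cascade\<close>

text \<open>Solutions live on the half line, so the derivative at 0 is one-sided. Inside the half
  line it is an ordinary derivative, and at the end points of the interval continuity
  suffices.\<close>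

lemma deriv_nonpos_imp_le:
  fixes f f' :: "real \<Rightarrow> real"
  assumes f: "\<And>t. t \<ge> 0 \<Longrightarrow> (f has_real_derivative f' t) (at t within {0..})"
    and le: "\<And>t. a \<le> t \<Longrightarrow> t \<le> b \<Longrightarrow> f' t \<le> 0" and ab: "0 \<le> a" "a \<le> b"
  shows "f b \<le> f a"
proof (rule DERIV_nonpos_imp_decreasing_open[OF ab(2)])
  fix x assume x: "a < x" "x < b"
  have "at x within {0..} = at x"
    using x ab by (intro at_within_interior) auto
  then show "\<exists>y. DERIV f x :> y \<and> y \<le> 0"
    using f[of x] le[of x] x ab by auto
next
  have "continuous_on {0..} f"
    using f by (meson DERIV_continuous_on atLeast_iff)
  then show "continuous_on {a..b} f"
    using ab by (auto intro: continuous_on_subset)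
qed

text \<open>Contraction is available only from positive times, so the grid of windows starts at
  \<open>T\<close> rather than at 0. The loss of this first window and the rounding down to the grid
  cost one factor \<rho> each, hence the division by the square of \<rho>.\<close>

lemma antimono_contraction_exp_decay:
  fixes V :: "real \<Rightarrow> real"
  assumes T: "T > 0" and \<rho>: "0 < \<rho>" "\<rho> < 1"
    and anti: "\<And>s t. 0 \<le> s \<Longrightarrow> s \<le> t \<Longrightarrow> V t \<le> V s"
    and step: "\<And>t. t > 0 \<Longrightarrow> V (t + T) \<le> \<rho> * V t"
    and nonneg: "V 0 \<ge> 0" and t: "t \<ge> 0"
  shows "V t \<le> exp (ln \<rho> / T * t) / \<rho>\<^sup>2 * V 0"
proof -
  have steps: "V (T + real n * T) \<le> \<rho> ^ n * V 0" for n
  proof (induction n)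
    case 0
    then show ?case using anti[of 0 T] T by simp
  next
    case (Suc n)
    have "V (T + real (Suc n) * T) \<le> \<rho> * V (T + real n * T)"
      using step[of "T + real n * T"] T by (simp add: algebra_simps add_pos_nonneg)
    also have "\<dots> \<le> \<rho> * (\<rho> ^ n * V 0)"
      using Suc \<rho> by (intro mult_left_mono) auto
    finally show ?case by simp
  qed
  define x where "x = t / T"
  have x: "x \<ge> 0" "t = x * T" using t T by (auto simp: x_def)
  have "V t \<le> exp (ln \<rho> * (x - 2)) * V 0"
  proof (cases "x \<ge> 1")
    case True
    \<comment> \<open>The last grid point \<open>T + n T\<close> not after \<open>t\<close>; the
      subtraction accounts for the grid starting at \<open>T\<close>, and \<open>n > x - 2\<close>
      is what the exponent needs.\<close>
    define n where "n = nat \<lfloor>x\<rfloor> - 1"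
    have n: "real n + 1 \<le> x" "x < real n + 2"
      using True unfolding n_def by linarith+
    have "V t \<le> V (T + real n * T)"
    proof (rule anti)
      show "0 \<le> T + real n * T" using T by simp
      have "(real n + 1) * T \<le> x * T" using n T by (intro mult_right_mono) auto
      then show "T + real n * T \<le> t" by (simp add: x(2) algebra_simps)
    qed
    also have "\<dots> \<le> \<rho> ^ n * V 0" by (rule steps)
    also have "\<rho> ^ n = exp (ln \<rho> * real n)"
      using \<rho> by (simp add: exp_of_nat_mult mult.commute)
    also have "exp (ln \<rho> * real n) * V 0 \<le> exp (ln \<rho> * (x - 2)) * V 0"
      using n \<rho> nonneg by (intro mult_right_mono) auto
    finally show ?thesis .
  next
    case False
    have "V t \<le> V 0" using anti t by simp
    also have "\<dots> \<le> exp (ln \<rho> * (x - 2)) * V 0"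
    proof -
      have "0 \<le> ln \<rho> * (x - 2)" using False \<rho> by (intro mult_nonpos_nonpos) auto
      then show ?thesis using nonneg by (simp add: mult_le_cancel_right1)
    qed
    finally show ?thesis .
  qed
  also have "exp (ln \<rho> * (x - 2)) = exp (ln \<rho> / T * t) / \<rho>\<^sup>2"
  proof -
    have "ln \<rho> * (x - 2) = ln \<rho> / T * t - 2 * ln \<rho>"
      using T by (simp add: x_def algebra_simps)
    moreover have "exp (2 * ln \<rho>) = \<rho>\<^sup>2"
      using \<rho> by (metis exp_ln exp_of_nat_mult of_nat_numeral)
    ultimately show ?thesis by (simp add: exp_diff)
  qed
  finally show ?thesis .
qed

section \<open>Decay of the localization error under persistent excitation\<close>

lemma has_real_derivative_inner:
  assumes "(f has_vector_derivative f') (at t within S)" "(g has_vector_derivative g') (at t within S)"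
  shows "((\<lambda>t. f t \<bullet> g t) has_real_derivative (f t \<bullet> g' + f' \<bullet> g t)) (at t within S)"
  unfolding has_field_derivative_def
  by (rule has_derivative_eq_rhs[OF has_derivative_inner[OF assms[unfolded has_vector_derivative_def]]])
     (auto simp: algebra_simps)

lemma has_vector_derivative_matrix_mult:
  fixes M :: "real ^ 'n ^ 'm"
  assumes "(f has_vector_derivative f') (at t within S)"
  shows "((\<lambda>t. M *v f t) has_vector_derivative M *v f') (at t within S)"
  using bounded_linear.has_vector_derivative[OF matrix_vector_mul_bounded_linear assms] .

lemma persistent_excitation_decay:
  fixes L :: "real \<Rightarrow> real ^ 'n ^ 'n" and k T a B :: real
  assumes pos: "k > 0" "T > 0" "a > 0" "B > 0"
    and psd: "\<And>t. t \<ge> 0 \<Longrightarrow> psd (L t)"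
    and bd: "\<And>t x. t \<ge> 0 \<Longrightarrow> x \<bullet> (L t *v x) \<le> B * (norm x)\<^sup>2"
    and cont: "continuous_on {0..} L"
    and exc: "\<And>t. t > 0 \<Longrightarrow> loewner_le (a *\<^sub>R mat 1) (integral {t..t+T} L)"
  obtains C \<gamma> where "C > 0" "\<gamma> > 0"
    "\<And>\<delta> t. \<lbrakk>\<And>t. t \<ge> 0 \<Longrightarrow> (\<delta> has_vector_derivative (- k *\<^sub>R (L t *v \<delta> t))) (at t within {0..}); t \<ge> 0\<rbrakk>
        \<Longrightarrow> (norm (\<delta> t))\<^sup>2 \<le> C * exp (- \<gamma> * t) * (norm (\<delta> 0))\<^sup>2"
proof -
  \<comment> \<open>\<open>k B / 2\<close> is the weight of \<open>V\<close> in the auxiliary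
    function \<open>G\<close> below, and \<open>exp T\<close> undoes its exponential factor over a
    window. In \<open>c\<close>, \<open>1 / k\<close> comes from integrating \<open>2 q\<close> and
    \<open>2 B K T\<close> from the displacement.\<close>
  define K where "K = exp T * (k * B / 2)"
  define c where "c = (1 / k + 2 * B * K * T) / a"
  \<comment> \<open>From V(t+T) \<le> V(t) \<le> c (V(t) - V(t+T)) follows (1 + c) V(t+T) \<le> c
    V(t). This ratio lies strictly between 0 and 1 for every positive \<open>c\<close>, so its
    logarithm is negative.\<close>
  define \<rho> where "\<rho> = c / (1 + c)"
  have K: "K > 0" using pos by (simp add: K_def)
  have c: "c > 0" using pos K by (simp add: c_def add_pos_pos)
  then have \<rho>: "0 < \<rho>" "\<rho> < 1" by (auto simp: \<rho>_def)
  show thesis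
  proof
    show "0 < 1 / \<rho>\<^sup>2" "0 < - (ln \<rho> / T)"
      using \<rho> pos by (auto simp: divide_neg_pos)
    fix \<delta> and t0 :: real
    assume \<delta>: "\<And>t. t \<ge> 0 \<Longrightarrow> (\<delta> has_vector_derivative (- k *\<^sub>R (L t *v \<delta> t))) (at t within {0..})"
      and t0: "t0 \<ge> 0"
    define V where "V = (\<lambda>t. (norm (\<delta> t))\<^sup>2)"
    define q where "q = (\<lambda>t. \<delta> t \<bullet> (L t *v \<delta> t))"
    have q0: "q t \<ge> 0" if "t \<ge> 0" for t
      using psd[OF that] by (simp add: q_def psd_def)
    have V': "(V has_real_derivative - 2 * k * q t) (at t within {0..})" if "t \<ge> 0" for t
      using has_real_derivative_inner[OF \<delta>[OF that] \<delta>[OF that]]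
      by (simp add: V_def q_def power2_norm_eq_inner inner_commute algebra_simps)
    have anti: "V t \<le> V s" if "0 \<le> s" "s \<le> t" for s t
      using that q0 pos by (intro deriv_nonpos_imp_le[OF V']) auto
    have step: "V (t + T) \<le> \<rho> * V t" if t: "t > 0" for t
    proof -
      define x0 where "x0 = \<delta> t"
      define d where "d = (\<lambda>s. \<delta> s - x0)"
      define \<Delta> where "\<Delta> = V t - V (t + T)"
      have d_le: "(norm (d s))\<^sup>2 \<le> K * \<Delta>" if s: "t \<le> s" "s \<le> t + T" for s
      proof -
        \<comment> \<open>The displacement on the window is controlled by the decrease of \<open>V\<close>: since
          \<open>V' = - 2 k q\<close> and \<open>\<bar>L \<delta>\<bar>\<^sup>2 \<le> B q\<close>, the term in \<open>V\<close> absorbs the growth of \<open>\<bar>d\<bar>\<^sup>2\<close>.\<close>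
        define G where "G = (\<lambda>u. exp (t - u) * (d u \<bullet> d u) + k * B / 2 * V u)"
        have d': "(d has_vector_derivative (- k *\<^sub>R (L u *v \<delta> u))) (at u within {0..})" if "u \<ge> 0" for u
          using \<delta>[OF that] unfolding d_def by (auto intro!: derivative_eq_intros)
        define G' where "G' = (\<lambda>u. exp (t - u) * (- 2 * k * (d u \<bullet> (L u *v \<delta> u)) - d u \<bullet> d u)
            - k * k * B * q u)"
        have G_deriv: "(G has_real_derivative G' u) (at u within {0..})" if "u \<ge> 0" for u
          unfolding G_def
          by (rule derivative_eq_intros has_real_derivative_inner[OF d'[OF that] d'[OF that]] V'[OF that] refl)+
             (simp add: G'_def inner_commute algebra_simps)
        have G'_le: "G' u \<le> 0" if u: "t \<le> u" for u
        proof -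
          have u0: "u \<ge> 0" using u t by simp
          \<comment> \<open>Young's inequality for the mixed term. The spare
            \<open>- d u \<bullet> d u\<close> that absorbs the square of \<open>d\<close> is the
            derivative of the factor \<open>exp (t - u)\<close>.\<close>
          have "0 \<le> (d u + k *\<^sub>R (L u *v \<delta> u)) \<bullet> (d u + k *\<^sub>R (L u *v \<delta> u))" by simp
          then have "- 2 * k * (d u \<bullet> (L u *v \<delta> u)) - d u \<bullet> d u \<le> k * k * (norm (L u *v \<delta> u))\<^sup>2"
            by (simp add: inner_add power2_norm_eq_inner inner_commute algebra_simps)
          also have "\<dots> \<le> k * k * (B * q u)"
            using psd_norm_mult_le[OF psd[OF u0] bd[OF u0] pos(4)] unfolding q_def
            by (intro mult_left_mono) auto
          finally have 1: "- 2 * k * (d u \<bullet> (L u *v \<delta> u)) - d u \<bullet> d u \<le> k * k * (B * q u)" .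
          have "exp (t - u) * (- 2 * k * (d u \<bullet> (L u *v \<delta> u)) - d u \<bullet> d u) \<le> exp (t - u) * (k * k * (B * q u))"
            using 1 by (intro mult_left_mono) auto
          also have "\<dots> \<le> 1 * (k * k * (B * q u))"
            using u pos q0[OF u0] by (intro mult_right_mono) auto
          finally show ?thesis by (simp add: G'_def)
        qed
        have "G s \<le> G t"
          using s t by (intro deriv_nonpos_imp_le[OF G_deriv]) (auto intro: G'_le)
        then have "exp (t - s) * (norm (d s))\<^sup>2 \<le> k * B / 2 * (V t - V s)"
          by (simp add: G_def d_def x0_def power2_norm_eq_inner algebra_simps)
        also have "\<dots> \<le> k * B / 2 * \<Delta>"
          using anti[of s "t + T"] s t pos by (intro mult_left_mono) (auto simp: \<Delta>_def)
        finally have 2: "exp (t - s) * (norm (d s))\<^sup>2 \<le> k * B / 2 * \<Delta>" .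
        have "(norm (d s))\<^sup>2 = exp (s - t) * (exp (t - s) * (norm (d s))\<^sup>2)"
          by (simp flip: mult.assoc exp_add)
        also have "\<dots> \<le> exp (s - t) * (k * B / 2 * \<Delta>)"
          using 2 by (intro mult_left_mono) auto
        also have "\<dots> \<le> exp T * (k * B / 2 * \<Delta>)"
          using s pos anti[of t "t + T"] t by (intro mult_right_mono) (auto simp: \<Delta>_def)
        finally show ?thesis by (simp add: K_def algebra_simps)
      qed
      have cont': "continuous_on {t..t+T} L"
        using cont t by (auto intro: continuous_on_subset)
      \<comment> \<open>For a fixed vector the quadratic form is linear in the matrix, so it
        commutes with the integral.\<close>
      have lin: "bounded_linear (\<lambda>M :: real ^ 'n ^ 'n. x0 \<bullet> (M *v x0))"
        by (intro linear_conv_bounded_linear[THEN iffD1] linearI)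
           (simp_all add: matrix_vector_mult_add_rdistrib inner_add_right scaleR_matrix_vector_assoc[symmetric])
      have "a * V t \<le> x0 \<bullet> (integral {t..t+T} L *v x0)"
      proof -
        have "0 \<le> x0 \<bullet> ((integral {t..t+T} L - a *\<^sub>R mat 1) *v x0)"
          using exc[OF t] by (simp add: loewner_le_def psd_def)
        then show ?thesis
          by (simp add: matrix_vector_mult_diff_rdistrib inner_diff_right V_def x0_def
              power2_norm_eq_inner scaleR_matrix_vector_assoc[symmetric])
      qed
      also have "\<dots> = integral {t..t+T} (\<lambda>s. x0 \<bullet> (L s *v x0))"
        using integral_linear[OF integrable_continuous_interval[OF cont'] lin] by (simp add: o_def)
      also have "\<dots> \<le> \<Delta> / k + 2 * B * (K * \<Delta>) * T"
      proof (rule has_integral_le)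
        show "((\<lambda>s. x0 \<bullet> (L s *v x0)) has_integral integral {t..t+T} (\<lambda>s. x0 \<bullet> (L s *v x0))) {t..t+T}"
          using integrable_linear[OF integrable_continuous_interval[OF cont'] lin]
          by (auto simp: o_def intro!: integrable_integral)
        \<comment> \<open>Since V' = - 2 k q, a primitive of the upper bound is known explicitly;
          this yields both its integrability and its integral.\<close>
        have "((\<lambda>s. - (V s) / k + 2 * B * (K * \<Delta>) * s) has_vector_derivative (2 * q s + 2 * B * (K * \<Delta>)))
            (at s within {t..t+T})" if "s \<in> {t..t+T}" for s
          using pos DERIV_subset[OF V'[of s], of "{t..t+T}"] that t
          by (auto intro!: derivative_eq_intros simp flip: has_real_derivative_iff_has_vector_derivative)
        then have "((\<lambda>s. 2 * q s + 2 * B * (K * \<Delta>)) has_integral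
            (- (V (t + T)) / k + 2 * B * (K * \<Delta>) * (t + T)) - (- (V t) / k + 2 * B * (K * \<Delta>) * t)) {t..t+T}"
          using pos by (intro fundamental_theorem_of_calculus) auto
        also have "(- (V (t + T)) / k + 2 * B * (K * \<Delta>) * (t + T)) - (- (V t) / k + 2 * B * (K * \<Delta>) * t)
            = \<Delta> / k + 2 * B * (K * \<Delta>) * T"
          unfolding \<Delta>_def by (simp add: algebra_simps diff_divide_distrib)
        finally show "((\<lambda>s. 2 * q s + 2 * B * (K * \<Delta>)) has_integral (\<Delta> / k + 2 * B * (K * \<Delta>) * T)) {t..t+T}" .
        fix s assume s: "s \<in> {t..t+T}"
        then have s0: "s \<ge> 0" using t by simp
        \<comment> \<open>The vector is \<open>\<delta> s + d s\<close>, while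
          \<open>x0 = \<delta> s - d s\<close>. The parallelogram identity for the form of
          \<open>L s\<close> bounds the value at \<open>x0\<close> once the value at the sum is
          dropped.\<close>
        have "0 \<le> (2 *\<^sub>R \<delta> s - x0) \<bullet> (L s *v (2 *\<^sub>R \<delta> s - x0))"
          using psd[OF s0] by (simp add: psd_def)
        then have "x0 \<bullet> (L s *v x0) \<le> 2 * q s + 2 * (d s \<bullet> (L s *v d s))"
          using psd_symmetric[OF psd[OF s0], of "\<delta> s" x0]
          by (simp add: q_def d_def matrix_vector_mult_diff_distrib matrix_vector_mult_scaleR inner_diff)
        also have "\<dots> \<le> 2 * q s + 2 * (B * (K * \<Delta>))"
          using order_trans[OF bd[OF s0, of "d s"] mult_left_mono[OF d_le, of s B]] s pos by simp
        finally show "x0 \<bullet> (L s *v x0) \<le> 2 * q s + 2 * B * (K * \<Delta>)" by simp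
      qed
      also have "\<dots> = a * (c * \<Delta>)"
        using pos by (simp add: c_def field_simps)
      finally have "V t \<le> c * (V t - V (t + T))"
        using pos by (simp add: \<Delta>_def)
      moreover have "V (t + T) \<le> V t" using anti t pos by simp
      ultimately show ?thesis
        using c by (simp add: \<rho>_def field_simps)
    qed
    have "V t0 \<le> exp (ln \<rho> / T * t0) / \<rho>\<^sup>2 * V 0"
      using anti step t0 by (intro antimono_contraction_exp_decay pos(2) \<rho>) (auto simp: V_def)
    then show "(norm (\<delta> t0))\<^sup>2 \<le> 1 / \<rho>\<^sup>2 * exp (- (- (ln \<rho> / T)) * t0) * (norm (\<delta> 0))\<^sup>2"
      by (simp add: V_def)
  qed
qed

section \<open>Decay of the second-order tracking error under an exponentially small input\<close>

lemma forced_decay_exp_le: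
  fixes W W' :: "real \<Rightarrow> real"
  assumes W: "\<And>t. t \<ge> 0 \<Longrightarrow> (W has_real_derivative W' t) (at t within {0..})"
    and le: "\<And>t. t \<ge> 0 \<Longrightarrow> W' t \<le> - c * W t + D * exp (- \<gamma> * t)"
    and c: "c < \<gamma>" and D: "D \<ge> 0" and t: "t \<ge> 0"
  shows "W t \<le> exp (- c * t) * (W 0 + D / (\<gamma> - c))"
proof -
  define e where "e = D / (\<gamma> - c)"
  have e: "D = (\<gamma> - c) * e" "e \<ge> 0" using c D by (auto simp: e_def)
  \<comment> \<open>The integrating factor \<open>exp (c * t)\<close> turns the forcing into
    \<open>D * exp (- (\<gamma> - c) * t)\<close>; the second summand is minus a primitive of it.
    Its decay needs \<open>c < \<gamma>\<close>.\<close>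
  define U where "U = (\<lambda>t. exp (c * t) * W t + e * exp (- (\<gamma> - c) * t))"
  have U': "(U has_real_derivative exp (c * s) * (W' s + c * W s) - D * exp (- (\<gamma> - c) * s)) (at s within {0..})"
    if "s \<ge> 0" for s
    unfolding U_def e(1)
    by (auto intro!: derivative_eq_intros W[OF that] simp: algebra_simps)
  have "U t \<le> U 0"
  proof (rule deriv_nonpos_imp_le[OF U'])
    fix s :: real assume s: "0 \<le> s"
    have "exp (c * s) * (W' s + c * W s) \<le> exp (c * s) * (D * exp (- \<gamma> * s))"
      using le[OF s] by (intro mult_left_mono) auto
    also have "\<dots> = D * exp (- (\<gamma> - c) * s)"
      by (simp add: algebra_simps flip: exp_add)
    finally show "exp (c * s) * (W' s + c * W s) - D * exp (- (\<gamma> - c) * s) \<le> 0" by simp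
  qed (use t in auto)
  moreover have "0 \<le> e * exp (- (\<gamma> - c) * t)"
    using e by simp
  ultimately have "exp (c * t) * W t \<le> W 0 + D / (\<gamma> - c)"
    unfolding e_def[symmetric] by (simp add: U_def)
  then have "exp (- c * t) * (exp (c * t) * W t) \<le> exp (- c * t) * (W 0 + D / (\<gamma> - c))"
    by (intro mult_left_mono) auto
  then show ?thesis by (simp flip: mult.assoc exp_add)
qed

lemma weighted_am_gm:
  fixes x y :: real
  assumes "\<eta> > 0"
  shows "x * y \<le> \<eta> * x\<^sup>2 + y\<^sup>2 / (4 * \<eta>)"
proof -
  have "0 \<le> (2 * \<eta> * x - y)\<^sup>2" by simp
  then show ?thesis using assms by (simp add: power2_eq_square field_simps)
qed

text \<open>The mechanical energy dissipates only \<open>y\<close>; the cross term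
  \<open>z \<bullet> y\<close> makes the dissipation strict in \<open>z\<close> as well. The input
  enters only through the decay bound on its square, which keeps this estimate independent of the
  dynamics of \<delta>.\<close>

lemma second_order_cascade_decay:
  fixes M :: "real ^ 'n ^ 'n" and kp kv \<gamma> :: real
  assumes M: "psd M" and pd: "\<And>x. x \<noteq> 0 \<Longrightarrow> 0 < x \<bullet> (M *v x)"
    and pos: "kp > 0" "kv > 0" "\<gamma> > 0"
  obtains C c where "C > 0" "c > 0" "c < \<gamma>"
    "\<And>\<delta> z y D t. \<lbrakk>\<And>t. t \<ge> 0 \<Longrightarrow> (norm (\<delta> t))\<^sup>2 \<le> D * exp (- \<gamma> * t);
        \<And>t. t \<ge> 0 \<Longrightarrow> (z has_vector_derivative y t) (at t within {0..});
        \<And>t. t \<ge> 0 \<Longrightarrow> (y has_vector_derivative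
          (- kp *\<^sub>R (M *v \<delta> t) - kp *\<^sub>R (M *v z t) - kv *\<^sub>R (M *v y t))) (at t within {0..});
        t \<ge> 0\<rbrakk>
      \<Longrightarrow> (norm (z t))\<^sup>2 + (norm (y t))\<^sup>2 \<le> C * exp (- c * t) * ((norm (z 0))\<^sup>2 + (norm (y 0))\<^sup>2 + D)"
proof -
  obtain \<mu> where \<mu>: "\<mu> > 0" "\<And>x. \<mu> * (norm x)\<^sup>2 \<le> x \<bullet> (M *v x)"
    using positive_definite_coercive[OF pd] by metis
  obtain B where B: "B > 0" "\<And>x. x \<bullet> (M *v x) \<le> B * (norm x)\<^sup>2" "\<And>x. norm (M *v x) \<le> B * norm x"
    using matrix_quadratic_bound by metis
  \<comment> \<open>The first bound lets \<open>\<epsilon> |y|^2\<close>, produced by the cross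
    term, use at most half of the dissipation \<open>kv \<mu> |y|^2\<close>. The second keeps the
    cross term below half of the guaranteed energy, so \<open>W\<close> remains positive
    definite.\<close>
  define \<epsilon> where "\<epsilon> = min (kv * \<mu> / 2) (sqrt (kp * \<mu>) / 2)"
  have \<epsilon>: "\<epsilon> > 0" "\<epsilon> \<le> kv * \<mu> / 2" using pos \<mu> by (auto simp: \<epsilon>_def)
  have \<epsilon>2: "\<epsilon>\<^sup>2 \<le> kp * \<mu> / 4"
  proof -
    have "\<epsilon>\<^sup>2 \<le> (sqrt (kp * \<mu>) / 2)\<^sup>2"
      using \<epsilon> by (intro power_mono) (auto simp: \<epsilon>_def)
    then show ?thesis using pos \<mu> by (simp add: power_divide)
  qed
  \<comment> \<open>The energy plus a small cross term; the weight \<open>\<epsilon> kv / 2\<close> cancels the indefinite term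
    \<open>- \<epsilon> kv (z \<bullet> M y)\<close> in its derivative.\<close>
  define W where "W = (\<lambda>z y :: real ^ 'n. 1 / 2 * (y \<bullet> y) + (kp + \<epsilon> * kv) / 2 * (z \<bullet> (M *v z)) + \<epsilon> * (z \<bullet> y))"
  define lo where "lo = min (1 / 4) (kp * \<mu> / 4)"
  define hi where "hi = 1 + \<epsilon> + (kp + \<epsilon> * kv) * B"
  \<comment> \<open>What is left of the dissipation: in \<open>y\<close>, one half goes to the cross
    term and one quarter to the input; in \<open>z\<close>, one half goes to the input. The constant
    \<open>c2\<close> is the price of these two input estimates in the weighted inequality.\<close>
  define \<kappa> where "\<kappa> = min (kv * \<mu> / 4) (\<epsilon> * kp * \<mu> / 2)"
  define c2 where "c2 = (kp * B)\<^sup>2 / (4 * (kv * \<mu> / 4)) + (\<epsilon> * kp * B)\<^sup>2 / (4 * (\<epsilon> * kp * \<mu> / 2))"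
  \<comment> \<open>The first entry converts the remaining dissipation into \<open>- c W\<close>;
    the second keeps the rate strictly below that of the input.\<close>
  define c where "c = min (\<kappa> / hi) (\<gamma> / 2)"
  have lo: "lo > 0" using pos \<mu> by (simp add: lo_def)
  have hi: "hi > 0" using pos B \<epsilon> by (simp add: hi_def add_pos_pos)
  have \<kappa>: "\<kappa> > 0" using pos \<mu> \<epsilon> by (simp add: \<kappa>_def)
  have c2: "c2 \<ge> 0" using pos \<mu> \<epsilon> by (simp add: c2_def)
  have c: "c > 0" "c < \<gamma>" "c * hi \<le> \<kappa>"
  proof -
    show "c > 0" "c < \<gamma>" using \<kappa> hi pos by (auto simp: c_def)
    have "c \<le> \<kappa> / hi" by (simp add: c_def)
    then show "c * hi \<le> \<kappa>" using hi by (simp add: field_simps)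
  qed
  have W_lo: "lo * ((norm z)\<^sup>2 + (norm y)\<^sup>2) \<le> W z y" for z y
  proof -
    have "- (z \<bullet> y) \<le> norm z * norm y"
      using Cauchy_Schwarz_ineq2[of z y] by linarith
    then have "- (\<epsilon> * (z \<bullet> y)) \<le> norm y * (\<epsilon> * norm z)"
      using \<epsilon>(1) mult_left_mono[of "- (z \<bullet> y)" "norm z * norm y" \<epsilon>] by (simp add: algebra_simps)
    also have "\<dots> \<le> 1 / 4 * (norm y)\<^sup>2 + (\<epsilon> * norm z)\<^sup>2 / (4 * (1 / 4))"
      by (rule weighted_am_gm) simp
    also have "\<dots> = (norm y)\<^sup>2 / 4 + \<epsilon>\<^sup>2 * (norm z)\<^sup>2" by (simp add: power_mult_distrib)
    also have "\<dots> \<le> (norm y)\<^sup>2 / 4 + kp * \<mu> / 4 * (norm z)\<^sup>2"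
      using mult_right_mono[OF \<epsilon>2, of "(norm z)\<^sup>2"] by simp
    finally have 1: "- (\<epsilon> * (z \<bullet> y)) \<le> (norm y)\<^sup>2 / 4 + kp * \<mu> / 4 * (norm z)\<^sup>2" .
    have "kp / 2 * (\<mu> * (norm z)\<^sup>2) \<le> (kp + \<epsilon> * kv) / 2 * (z \<bullet> (M *v z))"
      using pos \<epsilon> \<mu> by (intro mult_mono) auto
    then have 2: "kp * \<mu> / 4 * (norm z)\<^sup>2 + (norm y)\<^sup>2 / 4 \<le> W z y"
      using 1 by (simp add: W_def power2_norm_eq_inner)
    have "lo * (norm z)\<^sup>2 \<le> kp * \<mu> / 4 * (norm z)\<^sup>2" "lo * (norm y)\<^sup>2 \<le> 1 / 4 * (norm y)\<^sup>2"
      by (intro mult_right_mono; simp add: lo_def)+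
    with 2 show ?thesis by (simp add: distrib_left)
  qed
  have W_hi: "W z y \<le> hi * ((norm z)\<^sup>2 + (norm y)\<^sup>2)" for z y
  proof -
    have "z \<bullet> y \<le> norm z * norm y" by (rule norm_cauchy_schwarz)
    also have "\<dots> \<le> (norm z)\<^sup>2 + (norm y)\<^sup>2"
      using sum_squares_bound[of "norm z" "norm y"] zero_le_power2[of "norm z"] zero_le_power2[of "norm y"]
      by linarith
    finally have "\<epsilon> * (z \<bullet> y) \<le> \<epsilon> * ((norm z)\<^sup>2 + (norm y)\<^sup>2)"
      using \<epsilon> by (intro mult_left_mono) auto
    moreover have "(kp + \<epsilon> * kv) / 2 * (z \<bullet> (M *v z)) \<le> (kp + \<epsilon> * kv) * (B * ((norm z)\<^sup>2 + (norm y)\<^sup>2))"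
    proof (intro mult_mono)
      show "z \<bullet> (M *v z) \<le> B * ((norm z)\<^sup>2 + (norm y)\<^sup>2)"
        by (rule order_trans[OF B(2)]) (use B(1) in \<open>simp add: mult_left_mono\<close>)
      show "(kp + \<epsilon> * kv) / 2 \<le> kp + \<epsilon> * kv" "0 \<le> kp + \<epsilon> * kv" using pos \<epsilon> by auto
      show "0 \<le> z \<bullet> (M *v z)" using M by (simp add: psd_def)
    qed
    moreover have "(y \<bullet> y) / 2 \<le> (norm z)\<^sup>2 + (norm y)\<^sup>2"
      unfolding power2_norm_eq_inner using inner_ge_zero[of z] inner_ge_zero[of y] by linarith
    moreover have "hi * ((norm z)\<^sup>2 + (norm y)\<^sup>2) = ((norm z)\<^sup>2 + (norm y)\<^sup>2)
        + \<epsilon> * ((norm z)\<^sup>2 + (norm y)\<^sup>2) + (kp + \<epsilon> * kv) * (B * ((norm z)\<^sup>2 + (norm y)\<^sup>2))"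
      by (simp add: hi_def algebra_simps)
    ultimately show ?thesis
      unfolding W_def by linarith
  qed
  show thesis
  proof (rule that[OF _ c(1,2)])
    show "0 < (hi + c2 / (\<gamma> - c)) / lo" using lo hi c2 c by (simp add: add_pos_nonneg)
    fix \<delta> z y :: "real \<Rightarrow> real ^ 'n" and D t0 :: real
    assume \<delta>: "\<And>t. t \<ge> 0 \<Longrightarrow> (norm (\<delta> t))\<^sup>2 \<le> D * exp (- \<gamma> * t)"
      and z: "\<And>t. t \<ge> 0 \<Longrightarrow> (z has_vector_derivative y t) (at t within {0..})"
      and y: "\<And>t. t \<ge> 0 \<Longrightarrow> (y has_vector_derivative
          (- kp *\<^sub>R (M *v \<delta> t) - kp *\<^sub>R (M *v z t) - kv *\<^sub>R (M *v y t))) (at t within {0..})"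
      and t0: "t0 \<ge> 0"
    have D: "D \<ge> 0" using order_trans[OF zero_le_power2 \<delta>[of 0]] by simp
    define W' where "W' = (\<lambda>t. - kv * (y t \<bullet> (M *v y t)) + \<epsilon> * (y t \<bullet> y t) - \<epsilon> * kp * (z t \<bullet> (M *v z t))
        - kp * (y t \<bullet> (M *v \<delta> t)) - \<epsilon> * kp * (z t \<bullet> (M *v \<delta> t)))"
    have W': "((\<lambda>t. W (z t) (y t)) has_real_derivative W' t) (at t within {0..})" if "t \<ge> 0" for t
    proof -
      note d = has_real_derivative_inner[OF y[OF that] y[OF that]]
        has_real_derivative_inner[OF z[OF that] has_vector_derivative_matrix_mult[OF z[OF that]]]
        has_real_derivative_inner[OF z[OF that] y[OF that]]
      show ?thesis
        unfolding W_def
        by (rule DERIV_cong[OF DERIV_add[OF DERIV_add[OF DERIV_cmult[OF d(1)] DERIV_cmult[OF d(2)]] DERIV_cmult[OF d(3)]]])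
           (use psd_symmetric[OF M, of "y t" "z t"] in
             \<open>simp add: W'_def inner_diff inner_commute algebra_simps\<close>)
    qed
    have W'_le: "W' t \<le> - c * W (z t) (y t) + c2 * D * exp (- \<gamma> * t)" if t: "t \<ge> 0" for t
    proof -
      have cs: "- (u \<bullet> (M *v \<delta> t)) \<le> norm u * (B * norm (\<delta> t))" for u
      proof -
        have "- (u \<bullet> (M *v \<delta> t)) \<le> norm u * norm (M *v \<delta> t)"
          using Cauchy_Schwarz_ineq2[of u "M *v \<delta> t"] by linarith
        also have "\<dots> \<le> norm u * (B * norm (\<delta> t))"
          using B by (intro mult_left_mono) auto
        finally show ?thesis .
      qed
      have 1: "- (kp * (y t \<bullet> (M *v \<delta> t))) \<le> kv * \<mu> / 4 * (norm (y t))\<^sup>2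
          + (kp * B)\<^sup>2 / (4 * (kv * \<mu> / 4)) * (norm (\<delta> t))\<^sup>2"
      proof -
        have "- (kp * (y t \<bullet> (M *v \<delta> t))) \<le> norm (y t) * (kp * B * norm (\<delta> t))"
          using mult_left_mono[OF cs[of "y t"], of kp] pos by (simp add: algebra_simps)
        also have "\<dots> \<le> kv * \<mu> / 4 * (norm (y t))\<^sup>2 + (kp * B * norm (\<delta> t))\<^sup>2 / (4 * (kv * \<mu> / 4))"
          using pos \<mu> by (intro weighted_am_gm) simp
        finally show ?thesis by (simp add: power_mult_distrib)
      qed
      have 2: "- (\<epsilon> * kp * (z t \<bullet> (M *v \<delta> t))) \<le> \<epsilon> * kp * \<mu> / 2 * (norm (z t))\<^sup>2
          + (\<epsilon> * kp * B)\<^sup>2 / (4 * (\<epsilon> * kp * \<mu> / 2)) * (norm (\<delta> t))\<^sup>2"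
      proof -
        have "- (\<epsilon> * kp * (z t \<bullet> (M *v \<delta> t))) \<le> norm (z t) * (\<epsilon> * kp * B * norm (\<delta> t))"
          using mult_left_mono[OF cs[of "z t"], of "\<epsilon> * kp"] pos \<epsilon> by (simp add: algebra_simps)
        also have "\<dots> \<le> \<epsilon> * kp * \<mu> / 2 * (norm (z t))\<^sup>2 + (\<epsilon> * kp * B * norm (\<delta> t))\<^sup>2 / (4 * (\<epsilon> * kp * \<mu> / 2))"
          using pos \<mu> \<epsilon> by (intro weighted_am_gm) simp
        finally show ?thesis by (simp add: power_mult_distrib)
      qed
      have 3: "kv * (\<mu> * (norm (y t))\<^sup>2) \<le> kv * (y t \<bullet> (M *v y t))"
        using \<mu> pos by (intro mult_left_mono) auto
      have 4: "\<epsilon> * kp * (\<mu> * (norm (z t))\<^sup>2) \<le> \<epsilon> * kp * (z t \<bullet> (M *v z t))"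
        using \<mu> pos \<epsilon> by (intro mult_left_mono) auto
      have 5: "\<epsilon> * (y t \<bullet> y t) \<le> kv * \<mu> / 2 * (norm (y t))\<^sup>2"
        using mult_right_mono[OF \<epsilon>(2), of "(norm (y t))\<^sup>2"] by (simp add: power2_norm_eq_inner)
      have "W' t \<le> - (kv * \<mu> / 4 * (norm (y t))\<^sup>2) - \<epsilon> * kp * \<mu> / 2 * (norm (z t))\<^sup>2 + c2 * (norm (\<delta> t))\<^sup>2"
        using 1 2 3 4 5 by (simp add: W'_def c2_def algebra_simps)
      also have "\<dots> \<le> - (\<kappa> * ((norm (z t))\<^sup>2 + (norm (y t))\<^sup>2)) + c2 * (norm (\<delta> t))\<^sup>2"
      proof -
        have "\<kappa> * (norm (y t))\<^sup>2 \<le> kv * \<mu> / 4 * (norm (y t))\<^sup>2"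
          "\<kappa> * (norm (z t))\<^sup>2 \<le> \<epsilon> * kp * \<mu> / 2 * (norm (z t))\<^sup>2"
          by (intro mult_right_mono; simp add: \<kappa>_def)+
        then show ?thesis by (simp add: distrib_left)
      qed
      also have "\<dots> \<le> - (c * W (z t) (y t)) + c2 * (D * exp (- \<gamma> * t))"
      proof -
        have "c * W (z t) (y t) \<le> c * (hi * ((norm (z t))\<^sup>2 + (norm (y t))\<^sup>2))"
          using W_hi c by (intro mult_left_mono) auto
        also have "\<dots> \<le> \<kappa> * ((norm (z t))\<^sup>2 + (norm (y t))\<^sup>2)"
          using c(3) by (simp add: mult_right_mono flip: mult.assoc)
        finally show ?thesis using mult_left_mono[OF \<delta>[OF t] c2] by linarith
      qed
      finally show ?thesis by simp
    qed
    let ?N = "\<lambda>t. (norm (z t))\<^sup>2 + (norm (y t))\<^sup>2"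
    have "lo * ?N t0 \<le> W (z t0) (y t0)" by (rule W_lo)
    also have "\<dots> \<le> exp (- c * t0) * (W (z 0) (y 0) + c2 * D / (\<gamma> - c))"
      using c2 D by (intro forced_decay_exp_le[OF W' W'_le c(2) _ t0]) auto
    also have "\<dots> \<le> exp (- c * t0) * ((hi + c2 / (\<gamma> - c)) * (?N 0 + D))"
    proof (intro mult_left_mono)
      have "0 \<le> c2 / (\<gamma> - c) * ?N 0" "0 \<le> hi * D" using c2 c D hi by auto
      then show "W (z 0) (y 0) + c2 * D / (\<gamma> - c) \<le> (hi + c2 / (\<gamma> - c)) * (?N 0 + D)"
        using W_hi[of "z 0" "y 0"] by (simp add: distrib_left distrib_right)
    qed simp
    also have "\<dots> = lo * ((hi + c2 / (\<gamma> - c)) / lo * exp (- c * t0) * (?N 0 + D))"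
      using lo by simp
    finally show "?N t0 \<le> (hi + c2 / (\<gamma> - c)) / lo * exp (- c * t0) * (?N 0 + D)"
      using lo by (simp only: mult_le_cancel_left_pos)
  qed
qed

text \<open>The localization error is an exponentially small input to the tracking part, with
  \<open>D\<close> proportional to its initial square. Squared norms are estimated throughout, which
  explains the square root and the halved rate.\<close>

lemma cascade_exp_stable:
  fixes L :: "real \<Rightarrow> real ^ ('f::finite \<times> 'd::finite) ^ ('f \<times> 'd)" and M :: "real ^ ('f \<times> 'd) ^ ('f \<times> 'd)"
    and kd kp kv T a B :: real
  assumes pos: "kd > 0" "kp > 0" "kv > 0" "T > 0" "a > 0" "B > 0"
    and M: "psd M" "\<And>x. x \<noteq> 0 \<Longrightarrow> 0 < x \<bullet> (M *v x)"
    and L: "\<And>t. t \<ge> 0 \<Longrightarrow> psd (L t)" "\<And>t x. t \<ge> 0 \<Longrightarrow> x \<bullet> (L t *v x) \<le> B * (norm x)\<^sup>2"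
      "continuous_on {0..} L" "\<And>t. t > 0 \<Longrightarrow> loewner_le (a *\<^sub>R mat 1) (integral {t..t+T} L)"
  obtains C c where "C > 0" "c > 0"
    "\<And>x t. err_solution kd kp kv M L x \<Longrightarrow> t \<ge> 0 \<Longrightarrow> norm (x t) \<le> C * exp (- c * t) * norm (x 0)"
proof -
  obtain C1 \<gamma> where C1: "C1 > 0" "\<gamma> > 0"
    "\<And>\<delta> t. \<lbrakk>\<And>t. t \<ge> 0 \<Longrightarrow> (\<delta> has_vector_derivative (- kd *\<^sub>R (L t *v \<delta> t))) (at t within {0..}); t \<ge> 0\<rbrakk>
        \<Longrightarrow> (norm (\<delta> t))\<^sup>2 \<le> C1 * exp (- \<gamma> * t) * (norm (\<delta> 0))\<^sup>2"
    using persistent_excitation_decay[OF pos(1,4,5,6) L] by metis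
  obtain C2 c where C2: "C2 > 0" "c > 0" "c < \<gamma>"
    "\<And>\<delta> z y D t. \<lbrakk>\<And>t. t \<ge> 0 \<Longrightarrow> (norm (\<delta> t))\<^sup>2 \<le> D * exp (- \<gamma> * t);
        \<And>t. t \<ge> 0 \<Longrightarrow> (z has_vector_derivative y t) (at t within {0..});
        \<And>t. t \<ge> 0 \<Longrightarrow> (y has_vector_derivative
          (- kp *\<^sub>R (M *v \<delta> t) - kp *\<^sub>R (M *v z t) - kv *\<^sub>R (M *v y t))) (at t within {0..});
        t \<ge> 0\<rbrakk>
      \<Longrightarrow> (norm (z t))\<^sup>2 + (norm (y t))\<^sup>2 \<le> C2 * exp (- c * t) * ((norm (z 0))\<^sup>2 + (norm (y 0))\<^sup>2 + D)"
    using second_order_cascade_decay[OF M pos(2,3) C1(2)] by metis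
  \<comment> \<open>\<open>C1\<close> bounds the localization part and \<open>C2 * (1 + C1)\<close>
    the tracking part; \<open>c < \<gamma>\<close> lets both share the slower exponential.\<close>
  define K where "K = C1 + C2 + C2 * C1"
  have K: "K > 0" using C1 C2 by (simp add: K_def add_pos_pos)
  show thesis
  proof
    show "sqrt K > 0" "c / 2 > 0" using K C2 by auto
    fix x t assume x: "err_solution kd kp kv M L x" and t: "(t :: real) \<ge> 0"
    define \<delta> z y where "\<delta> = (\<lambda>t. fst (x t))" and "z = (\<lambda>t. fst (snd (x t)))" and "y = (\<lambda>t. snd (snd (x t)))"
    have x': "(x has_vector_derivative err_rhs kd kp kv M (L s) (x s)) (at s within {0..})" if "s \<ge> 0" for s
      using x that by (simp add: err_solution_def)
    have f: "bounded_linear (\<lambda>p :: ('f, 'd) err_state. fst p)"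
      "bounded_linear (\<lambda>p :: ('f, 'd) err_state. fst (snd p))"
      "bounded_linear (\<lambda>p :: ('f, 'd) err_state. snd (snd p))"
      by (auto intro: bounded_linear_compose bounded_linear_fst bounded_linear_snd)
    have d: "(\<delta> has_vector_derivative (- kd *\<^sub>R (L s *v \<delta> s))) (at s within {0..})"
      "(z has_vector_derivative y s) (at s within {0..})"
      "(y has_vector_derivative
          (- kp *\<^sub>R (M *v \<delta> s) - kp *\<^sub>R (M *v z s) - kv *\<^sub>R (M *v y s))) (at s within {0..})"
      if "s \<ge> 0" for s
      using f[THEN bounded_linear.has_vector_derivative, OF x'[OF that]]
      by (simp_all add: err_rhs_def \<delta>_def z_def y_def case_prod_beta)
    have norm_x: "(norm (x s))\<^sup>2 = (norm (\<delta> s))\<^sup>2 + ((norm (z s))\<^sup>2 + (norm (y s))\<^sup>2)" for s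
      by (simp add: \<delta>_def z_def y_def norm_prod_def)
    have \<delta>: "(norm (\<delta> s))\<^sup>2 \<le> C1 * (norm (\<delta> 0))\<^sup>2 * exp (- \<gamma> * s)" if "s \<ge> 0" for s
      using C1(3)[OF d(1) that] by (simp add: algebra_simps)
    have "(norm (x t))\<^sup>2 \<le> C1 * (norm (\<delta> 0))\<^sup>2 * exp (- \<gamma> * t)
        + C2 * exp (- c * t) * ((norm (z 0))\<^sup>2 + (norm (y 0))\<^sup>2 + C1 * (norm (\<delta> 0))\<^sup>2)"
      unfolding norm_x using \<delta>[OF t] C2(4)[OF \<delta> d(2,3) t] by (intro add_mono)
    also have "\<dots> \<le> C1 * (norm (x 0))\<^sup>2 * exp (- c * t)
        + C2 * exp (- c * t) * ((norm (x 0))\<^sup>2 + C1 * (norm (x 0))\<^sup>2)"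
      using C1 C2 t by (intro add_mono mult_mono mult_left_mono) (auto simp: norm_x mult_right_mono)
    also have "\<dots> = (sqrt K * exp (- (c / 2) * t) * norm (x 0))\<^sup>2"
    proof -
      have "(exp (- (c / 2) * t))\<^sup>2 = exp (- c * t)"
        by (simp flip: exp_double)
      then show ?thesis using K unfolding power_mult_distrib
        by (simp add: K_def algebra_simps)
    qed
    finally show "norm (x t) \<le> sqrt K * exp (- (c / 2) * t) * norm (x 0)"
      by (rule power2_le_imp_le) (use K in auto)
  qed
qed

section \<open>Block matrices\<close>

lemma stack_nth [simp]: "stack u $ (i, a) = u i $ a"
  by (simp add: stack_def)

lemma stack_add: "stack (\<lambda>i. u i + v i) = stack u + stack v"
  and stack_scaleR: "stack (\<lambda>i. c *\<^sub>R u i) = c *\<^sub>R stack u"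
  by (simp_all add: stack_def vec_eq_iff)

text \<open>Allows every vector to be read blockwise, so that matrix statements need checking only
  on stacked families.\<close>

lemma stack_cases:
  obtains u where "x = stack u"
proof
  show "x = stack (\<lambda>i. \<chi> a. x $ (i, a))"
    by (simp add: vec_eq_iff split_paired_all)
qed

lemma sum_UNIV_pair:
  "(\<Sum>x\<in>(UNIV :: ('a::finite \<times> 'b::finite) set). F x) = (\<Sum>i\<in>UNIV. \<Sum>j\<in>UNIV. F (i, j))"
  unfolding UNIV_Times_UNIV[symmetric] sum.cartesian_product[symmetric] by (simp add: sum.cartesian_product split_def)

lemma inner_stack: "stack u \<bullet> stack v = (\<Sum>i\<in>UNIV. u i \<bullet> v i)"
  by (simp add: inner_vec_def sum_UNIV_pair)

lemma has_vector_derivative_vec_nth: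
  fixes f :: "real \<Rightarrow> 'a::euclidean_space ^ 'n"
  shows
  "(f has_vector_derivative f') (at t within S) \<longleftrightarrow>
    (\<forall>i. ((\<lambda>t. f t $ i) has_vector_derivative f' $ i) (at t within S))"
proof
  assume "(f has_vector_derivative f') (at t within S)"
  then show "\<forall>i. ((\<lambda>t. f t $ i) has_vector_derivative f' $ i) (at t within S)"
    using bounded_linear.has_vector_derivative[OF bounded_linear_vec_nth] by blast
next
  assume *: "\<forall>i. ((\<lambda>t. f t $ i) has_vector_derivative f' $ i) (at t within S)"
  then show "(f has_vector_derivative f') (at t within S)"
    unfolding has_vector_derivative_def has_derivative_componentwise_within[of f]
    by (auto simp: Basis_vec_def inner_axis has_vector_derivative_def intro: has_derivative_inner_left[THEN has_derivative_eq_rhs])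
qed

lemma has_vector_derivative_stack:
  fixes u :: "real \<Rightarrow> 'v::finite \<Rightarrow> real ^ 'd"
  assumes "\<And>i. ((\<lambda>t. u t i) has_vector_derivative u' i) (at t within S)"
  shows "((\<lambda>t. stack (u t)) has_vector_derivative stack u') (at t within S)"
  unfolding has_vector_derivative_vec_nth
  using assms by (auto simp: has_vector_derivative_vec_nth)

lemma transpose_kron: "transpose (kron A B) = kron (transpose A) (transpose B)"
  by (simp add: transpose_def kron_def vec_eq_iff)

lemma kron_mat_1_stack:
  "kron A (mat 1) *v stack u = stack (\<lambda>i. \<Sum>j\<in>UNIV. A $ i $ j *\<^sub>R u j)"
proof -
  have "(kron A (mat 1) *v stack u) $ (i, a) = stack (\<lambda>i. \<Sum>j\<in>UNIV. A $ i $ j *\<^sub>R u j) $ (i, a)" for i a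
  proof -
    have "(kron A (mat 1) *v stack u) $ (i, a)
        = (\<Sum>j\<in>UNIV. \<Sum>b\<in>UNIV. A $ i $ j * (if a = b then 1 else 0) * u j $ b)"
      by (simp add: matrix_vector_mult_def kron_def mat_def sum_UNIV_pair)
    also have "\<dots> = (\<Sum>j\<in>UNIV. A $ i $ j * u j $ a)"
      by (rule sum.cong[OF refl]) (simp add: if_distrib if_distribR sum.delta cong: if_cong)
    finally show ?thesis by simp
  qed
  then show ?thesis by (auto simp: vec_eq_iff)
qed

lemma block_diag_stack: "block_diag P *v stack u = stack (\<lambda>k. P k *v u k)"
proof -
  have "(block_diag P *v stack u) $ (k, a) = stack (\<lambda>k. P k *v u k) $ (k, a)" for k a
  proof -
    have "(block_diag P *v stack u) $ (k, a)
        = (\<Sum>l\<in>UNIV. \<Sum>b\<in>UNIV. (if k = l then P k $ a $ b else 0) * u l $ b)"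
      by (simp add: matrix_vector_mult_def block_diag_def sum_UNIV_pair cong: if_cong)
    also have "\<dots> = (\<Sum>l\<in>UNIV. if k = l then \<Sum>b\<in>UNIV. P k $ a $ b * u l $ b else 0)"
      by (rule sum.cong[OF refl]) simp
    also have "\<dots> = (P k *v u k) $ a" by (simp add: matrix_vector_mult_def)
    finally show ?thesis by simp
  qed
  then show ?thesis by (auto simp: vec_eq_iff)
qed

text \<open>The follower block of a matrix is its compression to vectors vanishing on the leaders;
  this is the corresponding isometric embedding.\<close>

abbreviation extend :: "('f \<Rightarrow> real ^ 'd) \<Rightarrow> 'l + 'f \<Rightarrow> real ^ 'd"
  where "extend u \<equiv> case_sum (\<lambda>_. 0) u"

lemma sum_UNIV_sum:
  "(\<Sum>i\<in>(UNIV :: ('l::finite + 'f::finite) set). F i) = (\<Sum>i\<in>UNIV. F (Inl i)) + (\<Sum>i\<in>UNIV. F (Inr i))"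
  by (simp add: UNIV_Plus_UNIV[symmetric] sum.Plus del: UNIV_Plus_UNIV)

lemma ff_block_stack:
  assumes "M *v stack (extend u) = stack y"
  shows "ff_block M *v stack u = stack (\<lambda>i. y (Inr i))"
proof -
  have "(ff_block M *v stack u) $ (i, a) = y (Inr i) $ a" for i a
  proof -
    have "(ff_block M *v stack u) $ (i, a)
        = (\<Sum>j\<in>UNIV. \<Sum>b\<in>UNIV. M $ (Inr i, a) $ (Inr j, b) * u j $ b)"
      by (simp add: matrix_vector_mult_def ff_block_def sum_UNIV_pair)
    also have "\<dots> = (\<Sum>j\<in>UNIV. \<Sum>b\<in>UNIV. M $ (Inr i, a) $ (j, b) * extend u j $ b)"
      by (simp add: sum_UNIV_sum)
    also have "\<dots> = (M *v stack (extend u)) $ (Inr i, a)"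
      by (simp add: matrix_vector_mult_def sum_UNIV_pair)
    finally show ?thesis by (simp add: assms)
  qed
  then show ?thesis by (auto simp: vec_eq_iff)
qed

lemma inner_ff_block_stack:
  "stack u \<bullet> (ff_block M *v stack u') = stack (extend u) \<bullet> (M *v stack (extend u'))"
proof -
  obtain y where y: "M *v stack (extend u') = stack y" by (rule stack_cases)
  show ?thesis
    unfolding ff_block_stack[OF y] y inner_stack by (simp add: sum_UNIV_sum)
qed

lemma psd_ff_block:
  fixes M :: "real ^ (('l::finite + 'f::finite) \<times> 'd::finite) ^ (('l + 'f) \<times> 'd)"
  assumes "psd M"
  shows "psd (ff_block M)"
  unfolding psd_def
proof
  have "transpose M $ i $ j = M $ i $ j" for i j
    using assms by (simp add: psd_def)
  then have "M $ j $ i = M $ i $ j" for i j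
    by (simp add: transpose_def)
  then show "transpose (ff_block M) = ff_block M"
    by (simp add: transpose_def ff_block_def vec_eq_iff)
  show "\<forall>x. 0 \<le> x \<bullet> (ff_block M *v x)"
  proof
    fix x :: "real ^ ('f \<times> 'd)"
    obtain u where "x = stack u" by (rule stack_cases)
    then show "0 \<le> x \<bullet> (ff_block M *v x)"
      using assms by (simp add: inner_ff_block_stack psd_def)
  qed
qed

section \<open>Bearing Laplacian\<close>

lemma orth_proj_mult: "orth_proj g *v x = x - (g \<bullet> x) *\<^sub>R g"
  unfolding orth_proj_def matrix_vector_mult_diff_rdistrib matrix_vector_mul_lid
  by (simp add: matrix_vector_mult_def vec_eq_iff inner_vec_def sum_distrib_left mult.assoc mult.commute mult.left_commute)

lemma orth_proj_minus: "orth_proj (- g) = orth_proj g"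
  by (simp add: orth_proj_def)

lemma bearing_commute: "bearing p j i = - bearing p i j"
  unfolding bearing_def by (metis minus_diff_eq norm_minus_commute scaleR_minus_right)

text \<open>The relative position is a multiple of its bearing, or zero at coinciding points. This
  removes the true positions from the estimator.\<close>

lemma orth_proj_bearing_diff: "orth_proj (bearing p i j) *v (p i - p j) = 0"
proof -
  define e where "e = p j - p i"
  have "p i - p j = - e" by (simp add: e_def)
  moreover have "inverse (norm e) * (norm e * norm e) * inverse (norm e) = 1" if "e \<noteq> 0"
    using that by (simp add: field_simps)
  ultimately show ?thesis
    unfolding orth_proj_mult bearing_def e_def[symmetric]
    by (cases "e = 0") (simp_all add: dot_square_norm power2_eq_square)
qed

lemma transpose_orth_proj: "transpose (orth_proj g) = orth_proj g"
  by (simp add: orth_proj_def transpose_def mat_def vec_eq_iff mult.commute)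

text \<open>The norm is 1 except at coinciding points, where \<open>inverse 0 = 0\<close> makes the
  bearing zero.\<close>

lemma norm_bearing_le: "norm (bearing p i j) \<le> 1"
  by (cases "p j = p i") (simp_all add: bearing_def)

lemma orth_proj_inner_bounds:
  assumes "norm g \<le> 1"
  shows "0 \<le> x \<bullet> (orth_proj g *v x)" "x \<bullet> (orth_proj g *v x) \<le> (norm x)\<^sup>2"
proof -
  have eq: "x \<bullet> (orth_proj g *v x) = (norm x)\<^sup>2 - (g \<bullet> x)\<^sup>2"
    by (simp add: orth_proj_mult inner_diff_right dot_square_norm) (simp add: power2_eq_square inner_commute)
  have "\<bar>g \<bullet> x\<bar> \<le> norm g * norm x" by (rule Cauchy_Schwarz_ineq2)
  also have "\<dots> \<le> 1 * norm x" using assms by (intro mult_right_mono) auto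
  finally have "(g \<bullet> x)\<^sup>2 \<le> (norm x)\<^sup>2" by (simp add: abs_le_square_iff[symmetric])
  then show "0 \<le> x \<bullet> (orth_proj g *v x)" "x \<bullet> (orth_proj g *v x) \<le> (norm x)\<^sup>2"
    by (simp_all add: eq)
qed

text \<open>Moving the transposed incidence factor across the inner product leaves a form that is
  block diagonal over edges, so estimates reduce to a single projection.\<close>

lemma inner_bearing_laplacian:
  fixes tail head :: "'e::finite \<Rightarrow> 'v::finite" and p :: "'v \<Rightarrow> real ^ 'd"
  shows "x \<bullet> (bearing_laplacian tail head p *v y) =
    (kron (incidence tail head) (mat 1) *v x) \<bullet>
      (block_diag (\<lambda>k. orth_proj (bearing p (tail k) (head k))) *v (kron (incidence tail head) (mat 1) *v y))"
proof -
  have "x \<bullet> (transpose H *v z) = (H *v x) \<bullet> z" for H :: "real ^ ('v \<times> 'd) ^ ('e \<times> 'd)" and x z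
    by (metis dot_lmul_matrix vector_transpose_matrix)
  then show ?thesis
    by (simp add: bearing_laplacian_def Let_def flip: matrix_vector_mul_assoc)
qed

lemma transpose_block_diag: "transpose (block_diag P) = block_diag (\<lambda>k. transpose (P k))"
  by (simp add: block_diag_def transpose_def vec_eq_iff)

lemma psd_bearing_laplacian:
  fixes p :: "'v::finite \<Rightarrow> real ^ 'd"
  shows "psd (bearing_laplacian tail head p)"
  unfolding psd_def
proof
  show "transpose (bearing_laplacian tail head p) = bearing_laplacian tail head p"
    by (simp add: bearing_laplacian_def Let_def matrix_transpose_mul transpose_block_diag
        transpose_orth_proj matrix_mul_assoc)
  show "\<forall>x. 0 \<le> x \<bullet> (bearing_laplacian tail head p *v x)"
  proof
    fix x :: "real ^ ('v \<times> 'd)"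
    obtain u where u: "kron (incidence tail head) (mat 1 :: real ^ 'd ^ 'd) *v x = stack u" by (rule stack_cases)
    show "0 \<le> x \<bullet> (bearing_laplacian tail head p *v x)"
      unfolding inner_bearing_laplacian u block_diag_stack inner_stack
      by (intro sum_nonneg orth_proj_inner_bounds norm_bearing_le)
  qed
qed

text \<open>\<open>B\<close> is chosen before \<open>p\<close>: positions enter only through
  projections, which never exceed the identity, so a squared operator bound of the incidence factor
  works. Along a trajectory the bound is therefore independent of time.\<close>

lemma bearing_laplacian_bounded:
  fixes tail head :: "'e::finite \<Rightarrow> 'v::finite"
  obtains B where "B > 0"
    "\<And>(p :: 'v \<Rightarrow> real ^ 'd) x. x \<bullet> (bearing_laplacian tail head p *v x) \<le> B * (norm x)\<^sup>2"
proof -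
  obtain K where K: "K > 0" "\<And>x. norm (kron (incidence tail head) (mat 1 :: real ^ 'd ^ 'd) *v x) \<le> norm x * K"
    using bounded_linear.pos_bounded[OF matrix_vector_mul_bounded_linear] by blast
  show thesis
  proof
    show "K\<^sup>2 > 0" using K by simp
    fix p :: "'v \<Rightarrow> real ^ 'd" and x :: "real ^ ('v \<times> 'd)"
    obtain u where u: "kron (incidence tail head) (mat 1 :: real ^ 'd ^ 'd) *v x = stack u" by (rule stack_cases)
    have "x \<bullet> (bearing_laplacian tail head p *v x) \<le> (norm (kron (incidence tail head) (mat 1 :: real ^ 'd ^ 'd) *v x))\<^sup>2"
      unfolding inner_bearing_laplacian u block_diag_stack inner_stack power2_norm_eq_inner
      by (intro sum_mono) (simp flip: power2_norm_eq_inner add: orth_proj_inner_bounds norm_bearing_le)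
    also have "\<dots> \<le> (norm x * K)\<^sup>2"
      using K by (intro power_mono) auto
    finally show "x \<bullet> (bearing_laplacian tail head p *v x) \<le> K\<^sup>2 * (norm x)\<^sup>2"
      by (simp add: power_mult_distrib mult.commute)
  qed
qed

text \<open>Each neighbour of \<open>i\<close> belongs to exactly one edge at \<open>i\<close>. The
  orientation is invisible, because the incidence sign occurs twice and the projection is even in
  the bearing.\<close>

lemma bearing_laplacian_stack:
  fixes tail head :: "'e::finite \<Rightarrow> 'v::finite"
  assumes graph: "simple_graph E" "orientation E tail head"
  shows "bearing_laplacian tail head p *v stack u =
    stack (\<lambda>i. \<Sum>j\<in>nbrs E i. orth_proj (bearing p i j) *v (u i - u j))"
proof -
  let ?P = "\<lambda>k. orth_proj (bearing p (tail k) (head k))"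
  have bij: "bij_betw (\<lambda>k. {tail k, head k}) UNIV E"
    using graph by (simp add: orientation_def)
  \<comment> \<open>A loop would carry only the entry 1 in its incidence row, and the row would not
    act as a difference.\<close>
  have neq: "tail k \<noteq> head k" for k
  proof
    assume "tail k = head k"
    moreover have "{tail k, head k} \<in> E" using bij by (auto simp: bij_betw_def)
    ultimately show False using graph(1) by (force simp: simple_graph_def)
  qed
  let ?inc = "\<lambda>k. \<Sum>i\<in>UNIV. incidence tail head $ k $ i *\<^sub>R u i"
  have inc: "?inc k = u (head k) - u (tail k)" for k
  proof -
    have "?inc k = (\<Sum>i\<in>UNIV. (if i = head k then u i else 0) - (if i = tail k then u i else 0))"
      using neq[of k] by (intro sum.cong) (auto simp: incidence_def)
    then show ?thesis by (simp add: sum_subtractf)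
  qed
  have "(\<Sum>k\<in>UNIV. incidence tail head $ k $ i *\<^sub>R (?P k *v (u (head k) - u (tail k))))
      = (\<Sum>j\<in>nbrs E i. orth_proj (bearing p i j) *v (u i - u j))" for i
  proof -
    define other where "other = (\<lambda>k. if head k = i then tail k else head k)"
    let ?K = "{k. i = tail k \<or> i = head k}"
    have ends: "{tail k, head k} = {i, other k}" if "k \<in> ?K" for k
      using that by (auto simp: other_def)
    have "bij_betw other ?K (nbrs E i)"
      unfolding bij_betw_def
    proof
      show "inj_on other ?K"
      proof (rule inj_onI)
        fix k l assume "k \<in> ?K" "l \<in> ?K" "other k = other l"
        then have "{tail k, head k} = {tail l, head l}" using ends by metis
        then show "k = l" using bij by (auto simp: bij_betw_def inj_on_def)
      qed
      show "other ` ?K = nbrs E i"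
      proof (intro equalityI subsetI)
        fix j assume "j \<in> other ` ?K"
        then obtain k where k: "k \<in> ?K" "j = other k" by blast
        have "{tail k, head k} \<in> E" using bij by (auto simp: bij_betw_def)
        then show "j \<in> nbrs E i" unfolding ends[OF k(1)] k(2) by (simp add: nbrs_def)
      next
        fix j assume "j \<in> nbrs E i"
        then obtain k where k: "{i, j} = {tail k, head k}"
          using bij by (auto simp: nbrs_def bij_betw_def)
        then have "k \<in> ?K" "j = other k" unfolding other_def by (auto simp: doubleton_eq_iff)
        then show "j \<in> other ` ?K" by blast
      qed
    qed
    then have "(\<Sum>j\<in>nbrs E i. orth_proj (bearing p i j) *v (u i - u j))
        = (\<Sum>k\<in>?K. orth_proj (bearing p i (other k)) *v (u i - u (other k)))"
      by (simp add: sum.reindex_bij_betw[symmetric])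
    also have "\<dots> = (\<Sum>k\<in>?K. incidence tail head $ k $ i *\<^sub>R (?P k *v (u (head k) - u (tail k))))"
    proof (rule sum.cong[OF refl])
      fix k assume k: "k \<in> ?K"
      show "orth_proj (bearing p i (other k)) *v (u i - u (other k))
          = incidence tail head $ k $ i *\<^sub>R (?P k *v (u (head k) - u (tail k)))"
      proof (cases "i = head k")
        case True
        then have "orth_proj (bearing p i (other k)) = ?P k"
          using bearing_commute[of p "tail k" "head k"] by (simp add: other_def orth_proj_minus)
        then show ?thesis using True by (simp add: incidence_def other_def)
      next
        case False
        then have "i = tail k" "other k = head k" using k by (auto simp: other_def)
        then show ?thesis using False neq[of k]
          by (simp add: incidence_def matrix_vector_mult_diff_distrib)
      qed
    qed
    also have "\<dots> = (\<Sum>k\<in>UNIV. incidence tail head $ k $ i *\<^sub>R (?P k *v (u (head k) - u (tail k))))"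
      by (rule sum.mono_neutral_left) (auto simp: incidence_def)
    finally show ?thesis by simp
  qed
  then show ?thesis
    unfolding bearing_laplacian_def Let_def transpose_kron transpose_mat matrix_vector_mul_assoc[symmetric]
      kron_mat_1_stack inc block_diag_stack
    by (simp add: transpose_def)
qed

lemma sum_nbrs_split:
  fixes E :: "('l::finite + 'f::finite) set set"
  shows "(\<Sum>j\<in>nbrs E i. F j) = (\<Sum>j\<in>nbrs_f E i. F (Inr j)) + (\<Sum>j\<in>nbrs_l E i. F (Inl j))"
proof -
  have eq: "nbrs E i = nbrs_l E i <+> nbrs_f E i"
    by (auto simp: nbrs_l_def nbrs_f_def Plus_def image_iff) (metis sum.exhaust)+
  show ?thesis unfolding eq by (simp add: sum.Plus add.commute)
qed

text \<open>Leaders are extended by zero, since their positions are known exactly; this is why only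
  \<open>u i\<close> remains in the leader sum.\<close>

lemma L_Bff_stack:
  assumes "simple_graph E" "orientation E tail head"
  shows "L_Bff tail head p *v stack u =
    stack (\<lambda>i. (\<Sum>j\<in>nbrs_f E (Inr i). orth_proj (bearing p (Inr i) (Inr j)) *v (u i - u j))
             + (\<Sum>j\<in>nbrs_l E (Inr i). orth_proj (bearing p (Inr i) (Inl j)) *v u i))"
  unfolding L_Bff_def ff_block_stack[OF bearing_laplacian_stack[OF assms]]
  by (simp add: sum_nbrs_split)

lemma psd_L_Bff: "psd (L_Bff tail head p)"
  unfolding L_Bff_def by (intro psd_ff_block psd_bearing_laplacian)

lemma norm_stack_extend: "norm (stack (extend u :: 'l::finite + 'f::finite \<Rightarrow> real ^ 'd)) = norm (stack u)"
  by (simp add: norm_eq_sqrt_inner inner_stack sum_UNIV_sum)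

lemma L_Bff_bounded:
  fixes tail head :: "'e::finite \<Rightarrow> 'l::finite + 'f::finite"
  obtains B where "B > 0"
    "\<And>(p :: 'l + 'f \<Rightarrow> real ^ 'd) x. x \<bullet> (L_Bff tail head p *v x) \<le> B * (norm x)\<^sup>2"
proof -
  obtain B where B: "B > 0"
    "\<And>(p :: 'l + 'f \<Rightarrow> real ^ 'd) x. x \<bullet> (bearing_laplacian tail head p *v x) \<le> B * (norm x)\<^sup>2"
    using bearing_laplacian_bounded by metis
  show thesis
  proof (rule that[OF B(1)])
    fix p :: "'l + 'f \<Rightarrow> real ^ 'd" and x :: "real ^ ('f \<times> 'd)"
    obtain u where "x = stack u" by (rule stack_cases)
    then show "x \<bullet> (L_Bff tail head p *v x) \<le> B * (norm x)\<^sup>2"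
      unfolding L_Bff_def
      using B(2)[of "stack (extend u)" p] by (simp add: inner_ff_block_stack norm_stack_extend)
  qed
qed

text \<open>The bearing divides by the edge length, hence the distinct end points. Continuity
  supplies the integrability under which the window integral commutes with a quadratic form.\<close>

lemma continuous_on_L_Bff:
  fixes p :: "'t::topological_space \<Rightarrow> 'l::finite + 'f::finite \<Rightarrow> real ^ 'd"
  assumes "\<And>i. continuous_on S (\<lambda>t. p t i)" "\<And>t k. t \<in> S \<Longrightarrow> p t (tail k) \<noteq> p t (head k)"
  shows "continuous_on S (\<lambda>t. L_Bff tail head (p t))"
proof -
  have "continuous_on S (\<lambda>t. bearing (p t) (tail k) (head k))" for k
    unfolding bearing_def using assms(2)[of _ k]
    by (intro continuous_intros assms(1)) (metis norm_eq_zero right_minus_eq)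
  then have "continuous_on S (\<lambda>t. orth_proj (bearing (p t) (tail k) (head k)) $ a $ b)" for k a b
    unfolding orth_proj_def by (auto intro!: continuous_intros)
  then have "continuous_on S (\<lambda>t. block_diag (\<lambda>k. orth_proj (bearing (p t) (tail k) (head k))) $ x $ y)" for x y
    by (cases "fst x = fst y") (auto simp: block_diag_def)
  then have "continuous_on S (\<lambda>t. \<chi> x y. block_diag (\<lambda>k. orth_proj (bearing (p t) (tail k) (head k))) $ x $ y)"
    by (intro continuous_on_vec_lambda)
  then have "continuous_on S (\<lambda>t. block_diag (\<lambda>k. orth_proj (bearing (p t) (tail k) (head k))))"
    by simp
  then show ?thesis
    unfolding L_Bff_def ff_block_def bearing_laplacian_def Let_def matrix_matrix_mult_def
    by (auto intro!: continuous_intros)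
qed

section \<open>Positive definiteness of the follower stress block\<close>

lemma not_in_nbrs_self: "simple_graph E \<Longrightarrow> i \<notin> nbrs E i"
  unfolding simple_graph_def nbrs_def by fastforce

text \<open>Kept over an arbitrary real vector space: the kernel computation uses scalars, the
  control law positions.\<close>

lemma stress_matrix_sum:
  fixes u :: "'v::finite \<Rightarrow> 'a::real_vector"
  assumes "simple_graph E"
  shows "(\<Sum>j\<in>UNIV. stress_matrix E w $ i $ j *\<^sub>R u j) = (\<Sum>j\<in>nbrs E i. w i j *\<^sub>R (u i - u j))"
proof -
  have "(\<Sum>j\<in>UNIV. stress_matrix E w $ i $ j *\<^sub>R u j)
      = (\<Sum>j\<in>UNIV. (if j = i then (\<Sum>k\<in>nbrs E i. w i k) *\<^sub>R u i else 0)
          - (if j \<in> nbrs E i then w i j *\<^sub>R u j else 0))"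
    using not_in_nbrs_self[OF assms, of i] by (intro sum.cong) (auto simp: stress_matrix_def)
  also have "\<dots> = (\<Sum>k\<in>nbrs E i. w i k) *\<^sub>R u i - (\<Sum>j\<in>nbrs E i. w i j *\<^sub>R u j)"
    by (simp add: sum_subtractf sum.inter_restrict[symmetric])
  finally show ?thesis
    by (simp add: scaleR_sum_left scaleR_diff_right sum_subtractf)
qed

lemma Omega_ff_stack:
  assumes "simple_graph E"
  shows "Omega_ff E w *v stack u
    = stack (\<lambda>i. \<Sum>j\<in>nbrs E (Inr i). w (Inr i) j *\<^sub>R (u i - extend u j))"
  unfolding Omega_ff_def ff_block_stack[OF kron_mat_1_stack] stress_matrix_sum[OF assms] by simp

text \<open>The coordinates decouple, so the form is a sum of copies of the scalar form, one for
  each spatial direction.\<close>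

lemma inner_kron_mat_1:
  "stack u \<bullet> (kron M (mat 1) *v stack u) = (\<Sum>a\<in>UNIV. (\<chi> i. u i $ a) \<bullet> (M *v (\<chi> i. u i $ a)))"
proof -
  have "stack u \<bullet> (kron M (mat 1) *v stack u)
      = (\<Sum>i\<in>UNIV. \<Sum>a\<in>UNIV. u i $ a * (\<Sum>j\<in>UNIV. M $ i $ j * u j $ a))"
    unfolding kron_mat_1_stack inner_stack by (simp add: inner_vec_def)
  also have "\<dots> = (\<Sum>a\<in>UNIV. \<Sum>i\<in>UNIV. u i $ a * (\<Sum>j\<in>UNIV. M $ i $ j * u j $ a))"
    by (rule sum.swap)
  finally show ?thesis by (simp add: inner_vec_def matrix_vector_mult_def)
qed

lemma psd_kron_mat_1:
  fixes M :: "real ^ 'v::finite ^ 'v"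
  assumes "psd M"
  shows "psd (kron M (mat 1 :: real ^ 'd ^ 'd))"
  unfolding psd_def
proof
  show "transpose (kron M (mat 1 :: real ^ 'd ^ 'd)) = kron M (mat 1)"
    using assms by (simp add: transpose_kron psd_def transpose_mat)
  show "\<forall>x. 0 \<le> x \<bullet> (kron M (mat 1 :: real ^ 'd ^ 'd) *v x)"
  proof
    fix x :: "real ^ ('v \<times> 'd)"
    obtain u where "x = stack u" by (rule stack_cases)
    then show "0 \<le> x \<bullet> (kron M (mat 1) *v x)"
      using assms by (auto simp: inner_kron_mat_1 psd_def intro: sum_nonneg)
  qed
qed

lemma psd_Omega_ff: "psd (stress_matrix E w) \<Longrightarrow> psd (Omega_ff E w)"
  unfolding Omega_ff_def by (intro psd_ff_block psd_kron_mat_1)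

text \<open>The kernel of a symmetric matrix is the orthogonal complement of its range.\<close>

lemma dim_kernel_symmetric:
  fixes M :: "real ^ 'n ^ 'n"
  assumes "psd M"
  shows "dim {x. M *v x = 0} + rank M = CARD('n)"
proof -
  have "M *v x = 0 \<longleftrightarrow> (\<forall>y\<in>range ((*v) M). orthogonal y x)" for x
  proof -
    have "(\<forall>y. y \<bullet> (M *v x) = 0) \<longleftrightarrow> M *v x = 0"
      by (metis inner_eq_zero_iff inner_zero_right)
    then show ?thesis
      using psd_symmetric[OF assms, of x] by (simp add: orthogonal_def inner_commute)
  qed
  then have "{x. M *v x = 0} = {x \<in> UNIV. \<forall>y\<in>range ((*v) M). orthogonal y x}" by auto
  moreover have "dim {x \<in> UNIV. \<forall>y\<in>range ((*v) M). orthogonal y x} + dim (range ((*v) M)) = dim (UNIV :: (real ^ 'n) set)"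
    by (intro dim_subspace_orthogonal_to_vectors) (auto intro!: linear_subspace_image)
  ultimately show ?thesis
    by (simp add: rank_dim_range)
qed

text \<open>The translation cancels in differences and the linear map passes through the sum. The
  target space is general to cover both scalar functionals and the matrices
  \<open>A t\<close>.\<close>

lemma equilibrium_stress_affine:
  fixes F :: "real ^ 'd \<Rightarrow> 'a::real_normed_vector"
  assumes "equilibrium_stress E r w" "linear F"
  shows "(\<Sum>j\<in>nbrs E i. w i j *\<^sub>R ((F (r i) + b) - (F (r j) + b))) = 0"
proof -
  have "(\<Sum>j\<in>nbrs E i. w i j *\<^sub>R ((F (r i) + b) - (F (r j) + b)))
      = - F (\<Sum>j\<in>nbrs E i. w i j *\<^sub>R (r j - r i))"
    using assms(2) by (simp add: linear_sum linear_diff linear_cmul scaleR_diff_right sum_subtractf)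
  also have "(\<Sum>j\<in>nbrs E i. w i j *\<^sub>R (r j - r i)) = 0"
    using assms(1) unfolding equilibrium_stress_def by blast
  finally show ?thesis
    using assms(2) by (simp add: linear_0)
qed

text \<open>Equilibrium puts the affine functions of \<open>r\<close> into the kernel. They depend
  injectively on their coefficients, since one vanishing at all \<open>r i\<close> vanishes on the
  affine hull, which is everything; the rank condition leaves no room for more.\<close>

lemma stress_kernel_affine:
  fixes r :: "'v::finite \<Rightarrow> real ^ 'd"
  assumes E: "simple_graph E" and stress: "equilibrium_stress E r w"
    and span: "affine hull (range r) = UNIV"
    and psd: "psd (stress_matrix E w)"
    and rank: "rank (stress_matrix E w) + CARD('d) + 1 = CARD('v)"
    and y: "stress_matrix E w *v y = 0"
  obtains a b where "\<And>i. y $ i = a \<bullet> r i + b"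
proof -
  let ?ker = "{x. stress_matrix E w *v x = 0}"
  define \<Phi> :: "(real ^ 'd) \<times> real \<Rightarrow> real ^ 'v" where "\<Phi> = (\<lambda>ab. \<chi> i. fst ab \<bullet> r i + snd ab)"
  have lin: "linear \<Phi>"
    by (rule linearI) (simp_all add: \<Phi>_def vec_eq_iff inner_add_left algebra_simps)
  have "inj \<Phi>"
    unfolding linear_injective_0[OF lin]
  proof (intro allI impI)
    fix ab assume ab: "\<Phi> ab = 0"
    then have "range r \<subseteq> {x. fst ab \<bullet> x = - snd ab}"
      by (auto simp: \<Phi>_def vec_eq_iff add_eq_0_iff2)
    then have "affine hull (range r) \<subseteq> {x. fst ab \<bullet> x = - snd ab}"
      by (rule hull_minimal) (rule affine_hyperplane)
    then have *: "fst ab \<bullet> x = - snd ab" for x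
      using span by auto
    from *[of 0] have "snd ab = 0" by simp
    moreover from this *[of "fst ab"] have "fst ab = 0" by simp
    ultimately show "ab = 0" by (simp add: prod_eq_iff)
  qed
  then have "dim (range \<Phi>) = CARD('d) + 1"
    using dim_image_eq[OF lin, of UNIV] by simp
  moreover have "range \<Phi> \<subseteq> ?ker"
  proof clarify
    fix a :: "real ^ 'd" and b
    have "(stress_matrix E w *v \<Phi> (a, b)) $ i = 0" for i
    proof -
      have "(stress_matrix E w *v \<Phi> (a, b)) $ i
          = (\<Sum>j\<in>UNIV. stress_matrix E w $ i $ j *\<^sub>R (a \<bullet> r j + b))"
        by (simp add: matrix_vector_mult_def \<Phi>_def)
      also have "\<dots> = 0"
        unfolding stress_matrix_sum[OF E]
        by (rule equilibrium_stress_affine[OF stress]) (simp add: bounded_linear.linear bounded_linear_inner_right)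
      finally show ?thesis .
    qed
    then show "stress_matrix E w *v \<Phi> (a, b) = 0" by (simp add: vec_eq_iff)
  qed
  moreover have "dim ?ker = CARD('d) + 1"
    using dim_kernel_symmetric[OF psd] rank by linarith
  moreover have "subspace ?ker"
    by (intro linear_subspace_kernel) simp
  ultimately have "range \<Phi> = ?ker"
    using lin by (intro subspace_dim_equal) (auto intro: linear_subspace_image)
  with y obtain ab where "y = \<Phi> ab" by blast
  then show thesis using that by (simp add: \<Phi>_def)
qed

lemma Omega_ff_pos_def:
  fixes E :: "('l::finite + 'f::finite) set set" and r :: "'l + 'f \<Rightarrow> real ^ 'd"
  assumes E: "simple_graph E" and stress: "equilibrium_stress E r w"
    and span: "affine hull (range r) = UNIV"
    and psd: "psd (stress_matrix E w)"
    and rank: "rank (stress_matrix E w) + CARD('d) + 1 = CARD('l + 'f)"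
    and loc: "affinely_localizable r"
    and "x \<noteq> 0"
  shows "0 < x \<bullet> ((Omega_ff E w :: real ^ ('f \<times> 'd) ^ ('f \<times> 'd)) *v x)"
proof (rule ccontr)
  obtain u :: "'f \<Rightarrow> real ^ 'd" where u: "x = stack u" by (rule stack_cases)
  \<comment> \<open>The coordinate slices of the zero extension. Their forms are nonnegative, so a
    sum that is not positive puts each slice into the kernel.\<close>
  define y :: "'d \<Rightarrow> real ^ ('l + 'f)" where "y = (\<lambda>a. \<chi> i. extend u i $ a)"
  assume "\<not> ?thesis"
  moreover have "x \<bullet> (Omega_ff E w *v x) = (\<Sum>a\<in>UNIV. y a \<bullet> (stress_matrix E w *v y a))"
    unfolding u Omega_ff_def inner_ff_block_stack inner_kron_mat_1 y_def ..
  moreover have nonneg: "0 \<le> y a \<bullet> (stress_matrix E w *v y a)" for a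
    using psd by (simp add: psd_def)
  ultimately have "(\<Sum>a\<in>UNIV. y a \<bullet> (stress_matrix E w *v y a)) = 0"
    by (metis (no_types, lifting) not_less order_antisym sum_nonneg)
  then have "y a \<bullet> (stress_matrix E w *v y a) = 0" for a
    using nonneg by (simp add: sum_nonneg_eq_0_iff)
  then have ker: "stress_matrix E w *v y a = 0" for a
    using psd psd_kernel by blast
  have "u j $ a = 0" for j a
  proof -
    obtain c b where cb: "\<And>i. y a $ i = c \<bullet> r i + b"
      using stress_kernel_affine[OF E stress span psd rank ker[of a]] by blast
    \<comment> \<open>Localizability speaks of configurations, so the scalar function is repeated in
      every coordinate (all rows of the matrix equal \<open>c\<close>) and compared with the zero
      configuration.\<close>
    define q :: "'l + 'f \<Rightarrow> real ^ 'd" where "q = (\<lambda>i. \<chi> k. y a $ i)"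
    have "q i = (\<chi> k. c) *v r i + (\<chi> k. b)" for i
      by (simp add: q_def cb vec_eq_iff matrix_vector_mult_def inner_vec_def)
    then have "q \<in> affine_image r" unfolding affine_image_def by blast
    moreover have "(\<lambda>_. 0) \<in> affine_image r"
      unfolding affine_image_def by (auto intro!: exI[of _ 0])
    moreover have "q (Inl i) = 0" for i
      by (simp add: q_def y_def vec_eq_iff)
    ultimately have "q (Inr j) = 0"
      using loc unfolding affinely_localizable_def by metis
    then show ?thesis by (simp add: q_def y_def vec_eq_iff)
  qed
  then have "x = 0" by (simp add: u vec_eq_iff split_paired_all)
  with \<open>x \<noteq> 0\<close> show False ..
qed

section \<open>Closed loop\<close>

lemma skew_mult: "skew a *v x = cross3 a x"
  unfolding skew_def using bilinear_cross
  by (intro matrix_works) (simp add: bilinear_def linear_matrix_vector_mul_eq)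

lemma heading_unit: "heading al be \<bullet> heading al be = 1"
proof -
  have "heading al be \<bullet> heading al be
      = (cos be ^ 2 + sin be ^ 2) * cos al ^ 2 + sin al ^ 2"
    by (simp add: heading_def inner_vec_def sum_3 vector_3 power2_eq_square algebra_simps
        del: sin_cos_squared_add sin_cos_squared_add2 sin_cos_squared_add3)
  then show ?thesis by simp
qed

text \<open>The thrust cancels the component of \<open>f\<close> along \<open>h\<close> and the angular velocity the orthogonal
  one, by \<open>(h \<times> f) \<times> h = f - (h \<bullet> f) h\<close>.\<close>

lemma closed_loop_acceleration:
  assumes "h \<bullet> h = 1" "v \<noteq> 0"
  shows "- (h \<bullet> f) *\<^sub>R h + v *\<^sub>R (skew (- (1 / v) *\<^sub>R cross3 h f + al) *v h) = - f + v *\<^sub>R (skew al *v h)"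
proof -
  have "cross3 (cross3 h f) h = f - (h \<bullet> f) *\<^sub>R h"
    using assms(1) cross_skew[of "cross3 h f" h] by (simp add: Lagrange)
  then show ?thesis
    using assms(2) by (simp add: skew_mult cross_add_left cross_mult_left scaleR_add_right
        Cross3.left_diff_distrib scaleR_diff_right)
qed

text \<open>Used to differentiate identities known only for nonnegative times, including the
  one-sided case at the left end.\<close>

lemma has_vector_derivative_within_Ici_unique:
  fixes f :: "real \<Rightarrow> 'a::real_normed_vector"
  assumes "(f has_vector_derivative f') (at t within {a..})"
    "(f has_vector_derivative f'') (at t within {a..})" "a \<le> t"
  shows "f' = f''"
proof (rule vector_derivative_unique_within_closed_interval)
  show "t \<in> cbox a (t + 1)" "a < t + 1" using assms(3) by auto
  show "(f has_vector_derivative f') (at t within cbox a (t + 1))"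
    "(f has_vector_derivative f'') (at t within cbox a (t + 1))"
    using assms by (auto intro: has_vector_derivative_within_subset)
qed

text \<open>The middle component forces \<open>ev = 0\<close>; the last one is then
  \<open>- kp\<close> times \<open>Om\<close> applied to \<open>pt + \<delta>\<close>, and
  \<open>Om\<close> is injective.\<close>

lemma err_rhs_eq_0_iff:
  assumes "kd > 0" "kp > 0" and inj: "\<And>x. Om *v x = 0 \<Longrightarrow> x = 0"
  shows "err_rhs kd kp kv Om L (\<delta>, pt, ev) = 0 \<longleftrightarrow> L *v \<delta> = 0 \<and> pt + \<delta> = 0 \<and> ev = 0"
proof -
  have "- kp *\<^sub>R (Om *v \<delta>) - kp *\<^sub>R (Om *v pt) = - kp *\<^sub>R (Om *v (pt + \<delta>))"
    by (simp add: matrix_vector_right_distrib algebra_simps)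
  moreover have "Om *v (pt + \<delta>) = 0 \<longleftrightarrow> pt + \<delta> = 0"
    using inj by auto
  ultimately show ?thesis
    using assms(1,2) by (auto simp: err_rhs_def zero_prod_def)
qed

theorem theorem1:
  fixes E :: "('l::finite + 'f::finite) set set"
    and tail head :: "'e::finite \<Rightarrow> 'l + 'f"
    and w :: "'l + 'f \<Rightarrow> 'l + 'f \<Rightarrow> real"
    and r :: "'l + 'f \<Rightarrow> real ^ 3"
    and A :: "real \<Rightarrow> real ^ 3 ^ 3" and b :: "real \<Rightarrow> real ^ 3"
    and pst pst' pst'' :: "real \<Rightarrow> 'l + 'f \<Rightarrow> real ^ 3"
    and p pdot h \<omega> :: "real \<Rightarrow> 'l + 'f \<Rightarrow> real ^ 3"
    and v \<alpha> \<beta> \<tau> :: "real \<Rightarrow> 'l + 'f \<Rightarrow> real"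
    and \<omega>r :: "real ^ 3" and hr :: "real \<Rightarrow> real ^ 3"
    and phat f aleph :: "real \<Rightarrow> 'f \<Rightarrow> real ^ 3"
    and vst :: "real \<Rightarrow> 'f \<Rightarrow> real"
    and kd kp kv :: real
  assumes graph: "simple_graph E" "connected_graph E" "orientation E tail head"
    and gains: "kd > 0" "kp > 0" "kv > 0"
    \<comment> \<open>nominal formation\<close>
    and stress: "equilibrium_stress E r w"
    and span: "affine hull (range r) = UNIV"
    and stress_psd: "psd (stress_matrix E w)"
    and stress_rank: "rank (stress_matrix E w) + 3 + 1 = CARD('l + 'f)"
    and localizable: "affinely_localizable r"
    \<comment> \<open>desired formation\<close>
    and A_b: "continuous_on {0..} A" "continuous_on {0..} b" "\<And>t. t \<ge> 0 \<Longrightarrow> invertible (A t)"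
    and target: "\<And>t i. t \<ge> 0 \<Longrightarrow> pst t i = A t *v r i + b t"
    and target_deriv: "\<And>t i. t \<ge> 0 \<Longrightarrow>
          ((\<lambda>s. pst s i) has_vector_derivative pst' t i) (at t within {0..})"
    and target_deriv2: "\<And>t i. t \<ge> 0 \<Longrightarrow>
          ((\<lambda>s. pst' s i) has_vector_derivative pst'' t i) (at t within {0..})"
    and target_bounded: "\<And>i. bounded ((\<lambda>t. pst t i) ` {0..})" "\<And>i. bounded ((\<lambda>t. pst' t i) ` {0..})"
    and target_distinct: "\<And>t i j. t \<ge> 0 \<Longrightarrow> j \<in> nbrs E i \<Longrightarrow> norm (pst t j - pst t i) > 0"
    and target_accel: "\<And>t i. t \<ge> 0 \<Longrightarrow> pst'' t (Inr i) = vst t i *\<^sub>R (skew \<omega>r *v hr t)"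
    \<comment> \<open>no collision\<close>
    and no_collision: "\<And>t i j. t \<ge> 0 \<Longrightarrow> j \<in> nbrs E i \<Longrightarrow> p t i \<noteq> p t j"
    \<comment> \<open>UAV model\<close>
    and p_deriv: "\<And>t i. t \<ge> 0 \<Longrightarrow> ((\<lambda>s. p s i) has_vector_derivative pdot t i) (at t within {0..})"
    and p_model: "\<And>t i. t \<ge> 0 \<Longrightarrow> pdot t i = v t i *\<^sub>R h t i"
    and h_model: "\<And>t i. t \<ge> 0 \<Longrightarrow>
          ((\<lambda>s. h s i) has_vector_derivative skew (\<omega> t i) *v h t i) (at t within {0..})"
    and v_model: "\<And>t i. t \<ge> 0 \<Longrightarrow>
          ((\<lambda>s. v s i) has_real_derivative \<tau> t i) (at t within {0..})"
    and h_angles: "\<And>t i. t \<ge> 0 \<Longrightarrow> h t i = heading (\<alpha> t i) (\<beta> t i)"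
    \<comment> \<open>leaders\<close>
    and leaders: "\<And>t i. t \<ge> 0 \<Longrightarrow> p t (Inl i) = pst t (Inl i)"
      "\<And>t i. t \<ge> 0 \<Longrightarrow> \<tau> t (Inl i) = 0"
      "\<And>t i. t \<ge> 0 \<Longrightarrow> \<omega> t (Inl i) = \<omega>r"
      "\<And>t i. t \<ge> 0 \<Longrightarrow> h t (Inl i) = hr t"
    \<comment> \<open>localization and tracking scheme of the followers\<close>
    and v_nonzero: "\<And>t i. t \<ge> 0 \<Longrightarrow> v t (Inr i) \<noteq> 0"
    and estimator: "\<And>t i. t \<ge> 0 \<Longrightarrow>
          ((\<lambda>s. phat s i) has_vector_derivative
             (- kd *\<^sub>R (\<Sum>j\<in>nbrs_f E (Inr i).
                  orth_proj (bearing (p t) (Inr i) (Inr j)) *v (phat t i - phat t j))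
              - kd *\<^sub>R (\<Sum>j\<in>nbrs_l E (Inr i).
                  orth_proj (bearing (p t) (Inr i) (Inl j)) *v (phat t i - p t (Inl j)))
              + pdot t (Inr i))) (at t within {0..})"
    and thrust: "\<And>t i. t \<ge> 0 \<Longrightarrow> \<tau> t (Inr i) = - (h t (Inr i) \<bullet> f t i)"
    and ang_vel: "\<And>t i. t \<ge> 0 \<Longrightarrow>
          \<omega> t (Inr i) = - (1 / v t (Inr i)) *\<^sub>R cross3 (h t (Inr i)) (f t i) + aleph t i"
    and f_eq: "\<And>t i. t \<ge> 0 \<Longrightarrow>
          f t i = (\<Sum>j\<in>nbrs_f E (Inr i). (kp * w (Inr i) (Inr j)) *\<^sub>R (phat t i - phat t j))
                + (\<Sum>j\<in>nbrs_l E (Inr i). (kp * w (Inr i) (Inl j)) *\<^sub>R (phat t i - p t (Inl j)))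
                + (\<Sum>j\<in>nbrs E (Inr i). (kv * w (Inr i) j) *\<^sub>R
                     (v t (Inr i) *\<^sub>R h t (Inr i) - v t j *\<^sub>R h t j))"
    and aleph_eq: "\<And>t i. t \<ge> 0 \<Longrightarrow>
          skew (aleph t i) *v h t (Inr i) = (vst t i / v t (Inr i)) *\<^sub>R (skew \<omega>r *v hr t)"
  shows
    \<comment> \<open>closed-loop error dynamics\<close>
    "err_solution kd kp kv (Omega_ff E w) (\<lambda>t. L_Bff tail head (p t))
       (\<lambda>t. (stack (\<lambda>i. phat t i - p t (Inr i)),
             stack (\<lambda>i. p t (Inr i) - pst t (Inr i)),
             stack (\<lambda>i. pdot t (Inr i) - pst' t (Inr i))))
     \<and>
     \<comment> \<open>equilibria\<close>
     (\<forall>t\<ge>0.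
        {x. err_rhs kd kp kv (Omega_ff E w) (L_Bff tail head (p t)) x = 0} =
          {(\<delta>, pt, ev). L_Bff tail head (p t) *v \<delta> = 0 \<and> pt + \<delta> = 0 \<and> ev = 0} \<and>
        {x. err_rhs kd kp kv (Omega_ff E w) (L_Bff tail head (p t)) x = 0} =
          {(\<delta>, pt, ev).
             let pstf = stack (\<lambda>i. pst t (Inr i)); pf = pstf + pt; phatf = pf + \<delta>
             in L_Bff tail head (p t) *v \<delta> = 0 \<and> phatf = pstf \<and> ev = 0})
     \<and>
     \<comment> \<open>boundedness and exponential convergence\<close>
     ((\<exists>T>0. \<exists>a>0. \<forall>t>0.
         loewner_le (a *\<^sub>R mat 1) (integral {t..t+T} (\<lambda>s. L_Bff tail head (p s)))) \<longrightarrow>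
        (\<forall>x. err_solution kd kp kv (Omega_ff E w) (\<lambda>t. L_Bff tail head (p t)) x \<longrightarrow>
           bounded (x ` {0..})) \<and>
        (\<exists>C>0. \<exists>c>0. \<forall>x.
           err_solution kd kp kv (Omega_ff E w) (\<lambda>t. L_Bff tail head (p t)) x \<and>
           bounded (x ` {0..}) \<longrightarrow>
             (\<forall>t\<ge>0. norm (x t) \<le> C * exp (- c * t) * norm (x 0))))"
proof -
  let ?L = "\<lambda>t. L_Bff tail head (p t)"
  let ?Om = "Omega_ff E w :: real ^ ('f \<times> 3) ^ ('f \<times> 3)"
  have pd: "0 < x \<bullet> (?Om *v x)" if "x \<noteq> 0" for x
    using Omega_ff_pos_def[OF graph(1) stress span stress_psd _ localizable that] stress_rank by simp
  have inj: "x = 0" if "?Om *v x = 0" for x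
    using pd[of x] that by fastforce

  \<comment> \<open>Closed-loop error dynamics\<close>
  define \<delta> where "\<delta> = (\<lambda>t i. phat t i - p t (Inr i))"
  define pt where "pt = (\<lambda>t i. p t (Inr i) - pst t (Inr i))"
  define ev where "ev = (\<lambda>t i. pdot t (Inr i) - pst' t (Inr i))"

  have \<delta>_deriv: "((\<lambda>s. stack (\<delta> s)) has_vector_derivative - kd *\<^sub>R (?L t *v stack (\<delta> t))) (at t within {0..})"
    if t: "t \<ge> 0" for t
  proof -
    let ?\<pi> = "\<lambda>i j. orth_proj (bearing (p t) i j)"
    have d: "((\<lambda>s. \<delta> s i) has_vector_derivative - kd *\<^sub>R
        ((\<Sum>j\<in>nbrs_f E (Inr i). ?\<pi> (Inr i) (Inr j) *v (\<delta> t i - \<delta> t j))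
          + (\<Sum>j\<in>nbrs_l E (Inr i). ?\<pi> (Inr i) (Inl j) *v \<delta> t i))) (at t within {0..})" for i
    proof -
      have f: "?\<pi> (Inr i) (Inr j) *v (phat t i - phat t j) = ?\<pi> (Inr i) (Inr j) *v (\<delta> t i - \<delta> t j)" for j
      proof -
        have "phat t i - phat t j = (\<delta> t i - \<delta> t j) + (p t (Inr i) - p t (Inr j))" by (simp add: \<delta>_def)
        then show ?thesis
          by (simp only: matrix_vector_right_distrib orth_proj_bearing_diff add_0_right)
      qed
      have l: "?\<pi> (Inr i) (Inl j) *v (phat t i - p t (Inl j)) = ?\<pi> (Inr i) (Inl j) *v \<delta> t i" for j
      proof -
        have "phat t i - p t (Inl j) = \<delta> t i + (p t (Inr i) - p t (Inl j))" by (simp add: \<delta>_def)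
        then show ?thesis
          by (simp only: matrix_vector_right_distrib orth_proj_bearing_diff add_0_right)
      qed
      from has_vector_derivative_diff[OF estimator[OF t, of i] p_deriv[OF t, of "Inr i"]]
      show ?thesis unfolding f l \<delta>_def by (simp add: scaleR_add_right)
    qed
    show ?thesis
      using has_vector_derivative_stack[of \<delta>, OF d]
      by (simp only: L_Bff_stack[OF graph(1,3)] stack_scaleR[symmetric])
  qed

  have pt_deriv: "((\<lambda>s. stack (pt s)) has_vector_derivative stack (ev t)) (at t within {0..})" if t: "t \<ge> 0" for t
    unfolding pt_def ev_def by (intro has_vector_derivative_stack has_vector_derivative_diff p_deriv target_deriv t)

  have pst_stress: "(\<Sum>j\<in>nbrs E i. w i j *\<^sub>R (pst t i - pst t j)) = 0" if "t \<ge> 0" for t i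
    unfolding target[OF that] by (rule equilibrium_stress_affine[OF stress matrix_vector_mul_linear])
  \<comment> \<open>No derivatives of \<open>A\<close> and \<open>b\<close> are at hand, so the
    vanishing position identity is differentiated and uniqueness of the derivative applied.\<close>
  have pst'_stress: "(\<Sum>j\<in>nbrs E i. w i j *\<^sub>R (pst' t i - pst' t j)) = 0" if t: "t \<ge> 0" for t i
  proof (rule has_vector_derivative_within_Ici_unique)
    show "((\<lambda>s. \<Sum>j\<in>nbrs E i. w i j *\<^sub>R (pst s i - pst s j)) has_vector_derivative
        (\<Sum>j\<in>nbrs E i. w i j *\<^sub>R (pst' t i - pst' t j))) (at t within {0..})"
      by (intro has_vector_derivative_sum has_vector_derivative_diff target_deriv t
          bounded_linear.has_vector_derivative[OF bounded_linear_scaleR_right])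
    show "((\<lambda>s. \<Sum>j\<in>nbrs E i. w i j *\<^sub>R (pst s i - pst s j)) has_vector_derivative 0) (at t within {0..})"
      by (rule has_vector_derivative_transform[where f = "\<lambda>_. 0"]) (use t pst_stress in auto)
  qed (rule t)

  have leader_vel: "pdot t (Inl i) = pst' t (Inl i)" if t: "t \<ge> 0" for t i
  proof (rule has_vector_derivative_within_Ici_unique)
    show "((\<lambda>s. p s (Inl i)) has_vector_derivative pdot t (Inl i)) (at t within {0..})"
      by (rule p_deriv[OF t])
    show "((\<lambda>s. p s (Inl i)) has_vector_derivative pst' t (Inl i)) (at t within {0..})"
      by (rule has_vector_derivative_transform[OF _ _ target_deriv[OF t]]) (use t leaders(1) in auto)
  qed (rule t)

  \<comment> \<open>Subtracting the two vanishing target sums turns positions into errors: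
    \<open>phat - pst = \<delta> + pt\<close> on followers, and zero on leaders, which are on target
    in position and velocity.\<close>
  have f_stress: "f t i = kp *\<^sub>R (\<Sum>j\<in>nbrs E (Inr i). w (Inr i) j *\<^sub>R ((\<delta> t i + pt t i) - extend (\<lambda>j. \<delta> t j + pt t j) j))
      + kv *\<^sub>R (\<Sum>j\<in>nbrs E (Inr i). w (Inr i) j *\<^sub>R (ev t i - extend (ev t) j))" if t: "t \<ge> 0" for t i
  proof -
    let ?P = "\<lambda>j. case j of Inl k \<Rightarrow> p t (Inl k) | Inr k \<Rightarrow> phat t k"
    have P: "(\<delta> t i + pt t i) - extend (\<lambda>j. \<delta> t j + pt t j) j = (phat t i - ?P j) - (pst t (Inr i) - pst t j)" for j
      using leaders(1)[OF t] by (auto simp: \<delta>_def pt_def split: sum.split)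
    have V: "ev t i - extend (ev t) j = (pdot t (Inr i) - pdot t j) - (pst' t (Inr i) - pst' t j)" for j
      using leader_vel[OF t] by (auto simp: ev_def split: sum.split)
    have P_sum: "(\<Sum>j\<in>nbrs E (Inr i). w (Inr i) j *\<^sub>R ((\<delta> t i + pt t i) - extend (\<lambda>j. \<delta> t j + pt t j) j))
        = (\<Sum>j\<in>nbrs E (Inr i). w (Inr i) j *\<^sub>R (phat t i - ?P j))"
      unfolding P scaleR_diff_right[of _ "phat t i - _"] sum_subtractf pst_stress[OF t] by simp
    have V_sum: "(\<Sum>j\<in>nbrs E (Inr i). w (Inr i) j *\<^sub>R (ev t i - extend (ev t) j))
        = (\<Sum>j\<in>nbrs E (Inr i). w (Inr i) j *\<^sub>R (pdot t (Inr i) - pdot t j))"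
      unfolding V scaleR_diff_right[of _ "pdot t (Inr i) - _"] sum_subtractf pst'_stress[OF t] by simp
    show ?thesis
      unfolding P_sum V_sum f_eq[OF t] p_model[OF t, symmetric]
      by (simp add: sum_nbrs_split[where F = "\<lambda>j. w (Inr i) j *\<^sub>R (phat t i - ?P j)"] scaleR_add_right scaleR_sum_right)
  qed

  have f_Om: "stack (f t) = kp *\<^sub>R (?Om *v stack (\<delta> t)) + kp *\<^sub>R (?Om *v stack (pt t)) + kv *\<^sub>R (?Om *v stack (ev t))"
    if t: "t \<ge> 0" for t
  proof -
    have "stack (f t) = kp *\<^sub>R (?Om *v stack (\<lambda>i. \<delta> t i + pt t i)) + kv *\<^sub>R (?Om *v stack (ev t))"
      unfolding Omega_ff_stack[OF graph(1)] stack_scaleR[symmetric] stack_add[symmetric] f_stress[OF t, symmetric] ..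
    then show ?thesis
      by (simp add: stack_add matrix_vector_right_distrib scaleR_add_right)
  qed

  have ev_deriv: "((\<lambda>s. stack (ev s)) has_vector_derivative
      - kp *\<^sub>R (?Om *v stack (\<delta> t)) - kp *\<^sub>R (?Om *v stack (pt t)) - kv *\<^sub>R (?Om *v stack (ev t))) (at t within {0..})"
    if t: "t \<ge> 0" for t
  proof -
    have "((\<lambda>s. ev s i) has_vector_derivative - 1 *\<^sub>R f t i) (at t within {0..})" for i
    proof -
      let ?i = "Inr i :: 'l + 'f"
      have "((\<lambda>s. v s ?i *\<^sub>R h s ?i) has_vector_derivative
          (v t ?i *\<^sub>R (skew (\<omega> t ?i) *v h t ?i) + \<tau> t ?i *\<^sub>R h t ?i)) (at t within {0..})"
        by (rule has_vector_derivative_scaleR[OF v_model[OF t] h_model[OF t]])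
      then have "((\<lambda>s. pdot s ?i) has_vector_derivative
          (v t ?i *\<^sub>R (skew (\<omega> t ?i) *v h t ?i) + \<tau> t ?i *\<^sub>R h t ?i)) (at t within {0..})"
        by (rule has_vector_derivative_transform[rotated 2]) (use t p_model in auto)
      \<comment> \<open>The \<open>aleph\<close> term contributes \<open>v * (vst / v)\<close> times
        the common leader direction, which is exactly the desired acceleration and cancels in the
        derivative of \<open>ev\<close>.\<close>
      moreover have "v t ?i *\<^sub>R (skew (\<omega> t ?i) *v h t ?i) + \<tau> t ?i *\<^sub>R h t ?i = - f t i + pst'' t ?i"
      proof -
        have unit: "h t ?i \<bullet> h t ?i = 1"
          by (simp add: h_angles[OF t] heading_unit)
        have "v t ?i *\<^sub>R (skew (\<omega> t ?i) *v h t ?i) + \<tau> t ?i *\<^sub>R h t ?i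
            = - f t i + v t ?i *\<^sub>R (skew (aleph t i) *v h t ?i)"
          unfolding ang_vel[OF t] thrust[OF t]
          using closed_loop_acceleration[OF unit v_nonzero[OF t, of i], of "f t i" "aleph t i"] by (simp only: add.commute)
        then show ?thesis
          using v_nonzero[OF t, of i] by (simp add: aleph_eq[OF t] target_accel[OF t])
      qed
      ultimately show ?thesis
        using has_vector_derivative_diff[OF _ target_deriv2[OF t, of ?i]] unfolding ev_def by fastforce
    qed
    from has_vector_derivative_stack[of ev, OF this] show ?thesis
      unfolding stack_scaleR f_Om[OF t] by (simp add: algebra_simps)
  qed

  have dynamics: "err_solution kd kp kv ?Om ?L (\<lambda>t. (stack (\<delta> t), stack (pt t), stack (ev t)))"
    unfolding err_solution_def err_rhs_def prod.case
    by (intro allI impI has_vector_derivative_Pair \<delta>_deriv pt_deriv ev_deriv)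

  \<comment> \<open>Equilibrium set\<close>
  have equilibria: "{x. err_rhs kd kp kv ?Om (?L t) x = 0} =
        {(\<delta>, pt, ev). ?L t *v \<delta> = 0 \<and> pt + \<delta> = 0 \<and> ev = 0}" for t
    using err_rhs_eq_0_iff[OF gains(1,2) inj] by auto

  \<comment> \<open>Boundedness and exponential convergence\<close>
  have edge: "head k \<in> nbrs E (tail k)" for k
    using graph(3) by (auto simp: orientation_def nbrs_def bij_betw_def)
  have L_cont: "continuous_on {0..} ?L"
  proof (rule continuous_on_L_Bff)
    show "continuous_on {0..} (\<lambda>t. p t i)" for i
      using p_deriv by (intro continuous_on_vector_derivative) auto
    show "p t (tail k) \<noteq> p t (head k)" if "t \<in> {0..}" for t k
      using no_collision[OF _ edge] that by auto
  qed
  obtain B where B: "B > 0" "\<And>(p :: 'l + 'f \<Rightarrow> real ^ 3) x. x \<bullet> (L_Bff tail head p *v x) \<le> B * (norm x)\<^sup>2"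
    using L_Bff_bounded[where tail = tail and head = head] by blast

  have stability: "(\<forall>x. err_solution kd kp kv ?Om ?L x \<longrightarrow> bounded (x ` {0..})) \<and>
      (\<exists>C>0. \<exists>c>0. \<forall>x. err_solution kd kp kv ?Om ?L x \<and> bounded (x ` {0..}) \<longrightarrow>
             (\<forall>t\<ge>0. norm (x t) \<le> C * exp (- c * t) * norm (x 0)))"
    if exc: "T > 0" "a > 0" "\<forall>t>0. loewner_le (a *\<^sub>R mat 1) (integral {t..t+T} ?L)" for T a
  proof -
    obtain C c where C: "C > 0" "c > 0"
      "\<And>x t. err_solution kd kp kv ?Om ?L x \<Longrightarrow> t \<ge> 0 \<Longrightarrow> norm (x t) \<le> C * exp (- c * t) * norm (x 0)"
      using cascade_exp_stable[OF gains exc(1,2) B(1) psd_Omega_ff[OF stress_psd] pd psd_L_Bff B(2) L_cont] exc(3)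
      by metis
    \<comment> \<open>Boundedness is read off the exponential estimate, whose decaying factor is at
      most 1.\<close>
    have "bounded (x ` {0..})" if x: "err_solution kd kp kv ?Om ?L x" for x
    proof (rule boundedI)
      fix y assume "y \<in> x ` {0..}"
      then obtain t where t: "t \<ge> 0" "y = x t" by auto
      have "norm (x t) \<le> C * exp (- c * t) * norm (x 0)"
        by (rule C(3)[OF x t(1)])
      also have "\<dots> \<le> C * 1 * norm (x 0)"
        using C t by (intro mult_right_mono mult_left_mono) auto
      finally show "norm y \<le> C * 1 * norm (x 0)" using t by simp
    qed
    with C show ?thesis by blast
  qed

  show ?thesis
  proof (intro conjI)
    show "err_solution kd kp kv ?Om ?L
       (\<lambda>t. (stack (\<lambda>i. phat t i - p t (Inr i)),
             stack (\<lambda>i. p t (Inr i) - pst t (Inr i)),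
             stack (\<lambda>i. pdot t (Inr i) - pst' t (Inr i))))"
      using dynamics unfolding \<delta>_def pt_def ev_def .
    show "\<forall>t\<ge>0.
        {x. err_rhs kd kp kv ?Om (?L t) x = 0} =
          {(\<delta>, pt, ev). ?L t *v \<delta> = 0 \<and> pt + \<delta> = 0 \<and> ev = 0} \<and>
        {x. err_rhs kd kp kv ?Om (?L t) x = 0} =
          {(\<delta>, pt, ev).
             let pstf = stack (\<lambda>i. pst t (Inr i)); pf = pstf + pt; phatf = pf + \<delta>
             in ?L t *v \<delta> = 0 \<and> phatf = pstf \<and> ev = 0}"
      \<comment> \<open>By associativity \<open>phatf = pstf + (pt + \<delta>)\<close>, so
        cancelling \<open>pstf\<close> identifies the two descriptions.\<close>
      unfolding equilibria by (simp add: Let_def add.assoc)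
  qed (use stability in blast)
qed

end
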